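(* Let $X$ be a non-compact Gromov manifold and let $\Omega\subset\subset X$ be a compact domain with smooth, strictly Lagrangian convex boundary. Suppose $\rho$ is an arbitrary defining function for $\partial\Omega$ and let $\delta\equiv-\rho$ be the corresponding interior "distance function" to $\partial\Omega$. Then $-\log\delta$ is strictly Lagrangian plurisubharmonic outside a compact subset of $\Omega$. Thus, in particular, the domain $\Omega$ is strictly Lagrangian convex at infinity.
   Context: A Gromov manifold is a triple $(X,\omega,J)$ where $(X,\omega)$ is a symplectic manifold of real dimension $2n$ and $J$ is an almost complex structure with $\omega(v,w)=\omega(Jv,Jw)$ and $\omega(Jv,v)>0$ for all non-zero tangent vectors. It carries the riemannian metric $\langle v,w\rangle=\omega(Jv,w)$, with Levi-Civita connection $\nabla$ and riemannian Hessian $(\mathrm{Hess}\,f)(v,w)=vwf-(\nabla_vw)f$. An $n$-plane $W\subset T_xX$ is Lagrangian if $\omega|_W=0$, and $\mathrm{tr}_WA$ denotes the trace of the form $A$ restricted to $W$. A smooth function $f$ is Lagrangian plurisubharmonic (resp. strictly) if $\mathrm{tr}_W\mathrm{Hess}f\ge0$ (resp. $>0$) for all Lagrangian $W$ at all points. Here $\Omega\subset\subset X$ is an open set with smooth boundary and compact closure. A defining function for $\partial\Omega$ is a smooth function $\rho$ on a neighborhood of $\overline\Omega$ with $\Omega=\{\rho<0\}$ and $\nabla\rho\ne0$ on $\partial\Omega$. $\partial\Omega$ is strictly Lagrangian convex if for some (equivalently, every) defining function $\rho$, $\mathrm{tr}_W\mathrm{Hess}\rho>0$ for all Lagrangian $n$-planes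 $W\subset T_x\partial\Omega$, $x\in\partial\Omega$. $\Omega$ (itself a Gromov manifold) is strictly Lagrangian convex at infinity if it satisfies the following conditions, which are known to be equivalent: (i) there is a smooth Lagrangian plurisubharmonic proper exhaustion function on $\Omega$ which is strict outside a compact subset; (ii) there is a smooth strictly Lagrangian plurisubharmonic function $v$ defined on the complement of some compact subset of $\Omega$ with $v(x)\to\infty$ as $x\to\infty$ in $\Omega$. *)

theory Defs
  imports "HOL-Analysis.Analysis"
begin

section \<open>Smooth manifolds\<close>

text \<open>In the following two definitions the set is meant to be open.\<close>

primrec Ck_on :: "nat \<Rightarrow> 'a::euclidean_space set \<Rightarrow> ('a \<Rightarrow> 'b::real_normed_vector) \<Rightarrow> bool" where
  "Ck_on 0 S f \<longleftrightarrow> continuous_on S f"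
| "Ck_on (Suc k) S f \<longleftrightarrow>
     (\<forall>x\<in>S. f differentiable at x) \<and> (\<forall>v. Ck_on k S (\<lambda>x. frechet_derivative f (at x) v))"

definition smooth_on :: "'a::euclidean_space set \<Rightarrow> ('a \<Rightarrow> 'b::real_normed_vector) \<Rightarrow> bool" where
  "smooth_on S f \<longleftrightarrow> (\<forall>k. Ck_on k S f)"

type_synonym ('x, 'e) chart = "'x set \<times> ('x \<Rightarrow> 'e)"

definition param :: "('x, 'e) chart \<Rightarrow> 'e \<Rightarrow> 'x" where
  "param c = inv_into (fst c) (snd c)"

definition smooth_atlas ::
    "('x::{t2_space,second_countable_topology}, 'e::euclidean_space) chart set \<Rightarrow> bool" where
  "smooth_atlas A \<longleftrightarrow>
     (\<Union>c\<in>A. fst c) = UNIV \<and>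
     (\<forall>c\<in>A. open (fst c) \<and> open (snd c ` fst c) \<and>
        homeomorphism (fst c) (snd c ` fst c) (snd c) (param c)) \<and>
     (\<forall>c\<in>A. \<forall>d\<in>A. smooth_on (snd c ` (fst c \<inter> fst d)) (snd d \<circ> param c))"

text \<open>Every point gets a preferred chart, and the tangent space at \<open>x\<close> is modelled by \<open>'e\<close>, a
  vector \<open>v :: 'e\<close> standing for the tangent vector whose components in the preferred chart at
  \<open>x\<close> are \<open>v\<close>. A vector field is thus a function \<open>'x \<Rightarrow> 'e\<close>; since the preferred chart may
  jump from point to point, all differentiability is tested in the fixed charts of the atlas.\<close>

definition chart_at :: "('x, 'e) chart set \<Rightarrow> 'x \<Rightarrow> ('x, 'e) chart" where
  "chart_at A x = (SOME c. c \<in> A \<and> x \<in> fst c)"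

text \<open>The differential at \<open>x\<close> of (the map of) a chart, and its inverse, which gives the value at
  \<open>x\<close> of the coordinate vector field with constant components \<open>u\<close>.\<close>

definition chart_diff ::
    "('x, 'e::euclidean_space) chart set \<Rightarrow> ('x, 'e) chart \<Rightarrow> 'x \<Rightarrow> 'e \<Rightarrow> 'e" where
  "chart_diff A c x v =
     frechet_derivative (snd c \<circ> param (chart_at A x)) (at (snd (chart_at A x) x)) v"

definition coord_field ::
    "('x, 'e::euclidean_space) chart set \<Rightarrow> ('x, 'e) chart \<Rightarrow> 'e \<Rightarrow> 'x \<Rightarrow> 'e" where
  "coord_field A c u x = frechet_derivative (snd (chart_at A x) \<circ> param c) (at (snd c x)) u"

text \<open>The differential of a real function at \<open>x\<close>; for a vector field \<open>V\<close>, the derivative \<open>V f\<close> is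
  \<open>\<lambda>x. differential A f x (V x)\<close>.\<close>

definition differential ::
    "('x, 'e::euclidean_space) chart set \<Rightarrow> ('x \<Rightarrow> real) \<Rightarrow> 'x \<Rightarrow> 'e \<Rightarrow> real" where
  "differential A f x v =
     frechet_derivative (f \<circ> param (chart_at A x)) (at (snd (chart_at A x) x)) v"

definition smooth_fun_on ::
    "('x, 'e::euclidean_space) chart set \<Rightarrow> 'x set \<Rightarrow> ('x \<Rightarrow> real) \<Rightarrow> bool" where
  "smooth_fun_on A U f \<longleftrightarrow> (\<forall>c\<in>A. smooth_on (snd c ` (fst c \<inter> U)) (f \<circ> param c))"

definition smooth_field_on ::
    "('x, 'e::euclidean_space) chart set \<Rightarrow> 'x set \<Rightarrow> ('x \<Rightarrow> 'e) \<Rightarrow> bool" where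
  "smooth_field_on A U V \<longleftrightarrow>
     (\<forall>c\<in>A. smooth_on (snd c ` (fst c \<inter> U)) ((\<lambda>x. chart_diff A c x (V x)) \<circ> param c))"


section \<open>Gromov manifolds\<close>

definition form_in_chart ::
    "('x, 'e::euclidean_space) chart set \<Rightarrow> ('x \<Rightarrow> 'e \<Rightarrow> 'e \<Rightarrow> real) \<Rightarrow> ('x, 'e) chart \<Rightarrow>
     'e \<Rightarrow> 'e \<Rightarrow> 'e \<Rightarrow> real" where
  "form_in_chart A \<omega> c u v =
     (\<lambda>x. \<omega> x (coord_field A c u x) (coord_field A c v x)) \<circ> param c"

text \<open>The last conjunct is \<open>d\<omega> = 0\<close>, evaluated on coordinate vector fields (whose brackets vanish).\<close>

definition symplectic_form ::
    "('x, 'e::euclidean_space) chart set \<Rightarrow> ('x \<Rightarrow> 'e \<Rightarrow> 'e \<Rightarrow> real) \<Rightarrow> bool" where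
  "symplectic_form A \<omega> \<longleftrightarrow>
     (\<forall>x. bilinear (\<omega> x) \<and> (\<forall>v. \<omega> x v v = 0) \<and> (\<forall>v. v \<noteq> 0 \<longrightarrow> (\<exists>w. \<omega> x v w \<noteq> 0))) \<and>
     (\<forall>c\<in>A. \<forall>u v. smooth_on (snd c ` fst c) (form_in_chart A \<omega> c u v)) \<and>
     (\<forall>c\<in>A. \<forall>y\<in>snd c ` fst c. \<forall>u v w.
        frechet_derivative (form_in_chart A \<omega> c v w) (at y) u +
        frechet_derivative (form_in_chart A \<omega> c w u) (at y) v +
        frechet_derivative (form_in_chart A \<omega> c u v) (at y) w = 0)"

definition almost_complex_structure ::
    "('x, 'e::euclidean_space) chart set \<Rightarrow> ('x \<Rightarrow> 'e \<Rightarrow> 'e) \<Rightarrow> bool" where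
  "almost_complex_structure A J \<longleftrightarrow>
     (\<forall>x. linear (J x) \<and> (\<forall>v. J x (J x v) = - v)) \<and>
     (\<forall>c\<in>A. \<forall>u. smooth_on (snd c ` fst c)
        ((\<lambda>x. chart_diff A c x (J x (coord_field A c u x))) \<circ> param c))"

definition gromov_manifold ::
    "('x::{t2_space,second_countable_topology}, 'e::euclidean_space) chart set \<Rightarrow>
     ('x \<Rightarrow> 'e \<Rightarrow> 'e \<Rightarrow> real) \<Rightarrow> ('x \<Rightarrow> 'e \<Rightarrow> 'e) \<Rightarrow> bool" where
  "gromov_manifold A \<omega> J \<longleftrightarrow>
     smooth_atlas A \<and> symplectic_form A \<omega> \<and> almost_complex_structure A J \<and>
     (\<forall>x v w. \<omega> x (J x v) (J x w) = \<omega> x v w) \<and>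
     (\<forall>x v. v \<noteq> 0 \<longrightarrow> \<omega> x (J x v) v > 0)"

definition gromov_metric ::
    "('x \<Rightarrow> 'e \<Rightarrow> 'e \<Rightarrow> real) \<Rightarrow> ('x \<Rightarrow> 'e \<Rightarrow> 'e) \<Rightarrow> 'x \<Rightarrow> 'e \<Rightarrow> 'e \<Rightarrow> real" where
  "gromov_metric \<omega> J x v w = \<omega> x (J x v) w"


section \<open>The Levi-Civita connection and the Hessian\<close>

text \<open>Connections act on vector fields over arbitrary open sets \<open>U\<close>; they are determined only where
  their arguments are smooth.\<close>

definition affine_connection ::
    "('x::topological_space, 'e::euclidean_space) chart set \<Rightarrow>
     (('x \<Rightarrow> 'e) \<Rightarrow> ('x \<Rightarrow> 'e) \<Rightarrow> 'x \<Rightarrow> 'e) \<Rightarrow> bool" where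
  "affine_connection A nabla \<longleftrightarrow>
     (\<forall>U V W. open U \<longrightarrow> smooth_field_on A U V \<longrightarrow> smooth_field_on A U W \<longrightarrow>
        smooth_field_on A U (nabla V W) \<and>
        (\<forall>V'. smooth_field_on A U V' \<longrightarrow>
           (\<forall>x\<in>U. nabla (\<lambda>y. V y + V' y) W x = nabla V W x + nabla V' W x)) \<and>
        (\<forall>W'. smooth_field_on A U W' \<longrightarrow>
           (\<forall>x\<in>U. nabla V (\<lambda>y. W y + W' y) x = nabla V W x + nabla V W' x)) \<and>
        (\<forall>f. smooth_fun_on A U f \<longrightarrow>
           (\<forall>x\<in>U. nabla (\<lambda>y. f y *\<^sub>R V y) W x = f x *\<^sub>R nabla V W x \<and>
                  nabla V (\<lambda>y. f y *\<^sub>R W y) x =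
                    differential A f x (V x) *\<^sub>R W x + f x *\<^sub>R nabla V W x)))"

text \<open>Torsion-freeness \<open>nabla V W - nabla W V = [V, W]\<close> is expressed on functions, where
  \<open>[V, W] f = V (W f) - W (V f)\<close>.\<close>

definition levi_civita_connection ::
    "('x::topological_space, 'e::euclidean_space) chart set \<Rightarrow> ('x \<Rightarrow> 'e \<Rightarrow> 'e \<Rightarrow> real) \<Rightarrow>
     (('x \<Rightarrow> 'e) \<Rightarrow> ('x \<Rightarrow> 'e) \<Rightarrow> 'x \<Rightarrow> 'e) \<Rightarrow> bool" where
  "levi_civita_connection A g nabla \<longleftrightarrow>
     affine_connection A nabla \<and>
     (\<forall>U V W f. open U \<longrightarrow> smooth_field_on A U V \<longrightarrow> smooth_field_on A U W \<longrightarrow>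
        smooth_fun_on A U f \<longrightarrow>
        (\<forall>x\<in>U. differential A f x (nabla V W x - nabla W V x) =
           differential A (\<lambda>y. differential A f y (W y)) x (V x) -
           differential A (\<lambda>y. differential A f y (V y)) x (W x))) \<and>
     (\<forall>U V W Z. open U \<longrightarrow> smooth_field_on A U V \<longrightarrow> smooth_field_on A U W \<longrightarrow>
        smooth_field_on A U Z \<longrightarrow>
        (\<forall>x\<in>U. differential A (\<lambda>y. g y (W y) (Z y)) x (V x) =
           g x (nabla V W x) (Z x) + g x (W x) (nabla V Z x)))"

text \<open>\<open>(Hess f)(v, w) = v w f - (nabla v w) f\<close> requires extensions of \<open>v\<close> and \<open>w\<close> to vector fields near
  \<open>x\<close>, on which the result does not depend; here they are extended with constant components
  in the preferred chart at \<open>x\<close>.\<close>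

definition hessian ::
    "('x, 'e::euclidean_space) chart set \<Rightarrow> (('x \<Rightarrow> 'e) \<Rightarrow> ('x \<Rightarrow> 'e) \<Rightarrow> 'x \<Rightarrow> 'e) \<Rightarrow>
     ('x \<Rightarrow> real) \<Rightarrow> 'x \<Rightarrow> 'e \<Rightarrow> 'e \<Rightarrow> real" where
  "hessian A nabla f x v w =
     (let V = coord_field A (chart_at A x) v; W = coord_field A (chart_at A x) w
      in differential A (\<lambda>y. differential A f y (W y)) x (V x) -
         differential A f x (nabla V W x))"


section \<open>Lagrangian plurisubharmonicity and convexity\<close>

definition lagrangian_plane ::
    "('x \<Rightarrow> 'e \<Rightarrow> 'e \<Rightarrow> real) \<Rightarrow> 'x \<Rightarrow> 'e::euclidean_space set \<Rightarrow> bool" where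
  "lagrangian_plane \<omega> x W \<longleftrightarrow>
     subspace W \<and> 2 * dim W = DIM('e) \<and> (\<forall>v\<in>W. \<forall>w\<in>W. \<omega> x v w = 0)"

text \<open>The trace of a bilinear form \<open>B\<close> on \<open>W\<close> with respect to the inner product \<open>g\<close>, computed in a
  \<open>g\<close>-orthonormal basis of \<open>W\<close>.\<close>

definition trace_on ::
    "('e::euclidean_space \<Rightarrow> 'e \<Rightarrow> real) \<Rightarrow> 'e set \<Rightarrow> ('e \<Rightarrow> 'e \<Rightarrow> real) \<Rightarrow> real" where
  "trace_on g W B =
     (\<Sum>e\<in>(SOME E. finite E \<and> span E = W \<and>
             (\<forall>a\<in>E. \<forall>b\<in>E. g a b = (if a = b then 1 else 0))). B e e)"

definition lagrangian_psh_on ::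
    "('x, 'e::euclidean_space) chart set \<Rightarrow> ('x \<Rightarrow> 'e \<Rightarrow> 'e \<Rightarrow> real) \<Rightarrow> ('x \<Rightarrow> 'e \<Rightarrow> 'e) \<Rightarrow>
     (('x \<Rightarrow> 'e) \<Rightarrow> ('x \<Rightarrow> 'e) \<Rightarrow> 'x \<Rightarrow> 'e) \<Rightarrow> 'x set \<Rightarrow> ('x \<Rightarrow> real) \<Rightarrow> bool" where
  "lagrangian_psh_on A \<omega> J nabla U f \<longleftrightarrow>
     smooth_fun_on A U f \<and>
     (\<forall>x\<in>U. \<forall>W. lagrangian_plane \<omega> x W \<longrightarrow>
        trace_on (gromov_metric \<omega> J x) W (hessian A nabla f x) \<ge> 0)"

definition strictly_lagrangian_psh_on ::
    "('x, 'e::euclidean_space) chart set \<Rightarrow> ('x \<Rightarrow> 'e \<Rightarrow> 'e \<Rightarrow> real) \<Rightarrow> ('x \<Rightarrow> 'e \<Rightarrow> 'e) \<Rightarrow>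
     (('x \<Rightarrow> 'e) \<Rightarrow> ('x \<Rightarrow> 'e) \<Rightarrow> 'x \<Rightarrow> 'e) \<Rightarrow> 'x set \<Rightarrow> ('x \<Rightarrow> real) \<Rightarrow> bool" where
  "strictly_lagrangian_psh_on A \<omega> J nabla U f \<longleftrightarrow>
     smooth_fun_on A U f \<and>
     (\<forall>x\<in>U. \<forall>W. lagrangian_plane \<omega> x W \<longrightarrow>
        trace_on (gromov_metric \<omega> J x) W (hessian A nabla f x) > 0)"

definition compact_domain ::
    "('x::topological_space, 'e::euclidean_space) chart set \<Rightarrow> 'x set \<Rightarrow> bool" where
  "compact_domain A \<Omega> \<longleftrightarrow>
     open \<Omega> \<and> compact (closure \<Omega>) \<and>
     (\<forall>p\<in>frontier \<Omega>. \<exists>N r. open N \<and> p \<in> N \<and> smooth_fun_on A N r \<and>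
        (\<exists>v. differential A r p v \<noteq> 0) \<and> \<Omega> \<inter> N = {x\<in>N. r x < 0})"

definition defining_function ::
    "('x::topological_space, 'e::euclidean_space) chart set \<Rightarrow> 'x set \<Rightarrow> ('x \<Rightarrow> real) \<Rightarrow> bool" where
  "defining_function A \<Omega> \<rho> \<longleftrightarrow>
     (\<exists>N. open N \<and> closure \<Omega> \<subseteq> N \<and> smooth_fun_on A N \<rho> \<and> \<Omega> = {x\<in>N. \<rho> x < 0} \<and>
        (\<forall>x\<in>frontier \<Omega>. \<exists>v. differential A \<rho> x v \<noteq> 0))"

text \<open>The tangent space of the boundary at \<open>x\<close> is the kernel of the differential of a defining
  function.\<close>

definition strictly_lagrangian_convex_boundary ::
    "('x::topological_space, 'e::euclidean_space) chart set \<Rightarrow> ('x \<Rightarrow> 'e \<Rightarrow> 'e \<Rightarrow> real) \<Rightarrow>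
     ('x \<Rightarrow> 'e \<Rightarrow> 'e) \<Rightarrow> (('x \<Rightarrow> 'e) \<Rightarrow> ('x \<Rightarrow> 'e) \<Rightarrow> 'x \<Rightarrow> 'e) \<Rightarrow> 'x set \<Rightarrow> bool" where
  "strictly_lagrangian_convex_boundary A \<omega> J nabla \<Omega> \<longleftrightarrow>
     (\<exists>r. defining_function A \<Omega> r \<and>
        (\<forall>x\<in>frontier \<Omega>. \<forall>W. lagrangian_plane \<omega> x W \<and> W \<subseteq> {v. differential A r x v = 0} \<longrightarrow>
           trace_on (gromov_metric \<omega> J x) W (hessian A nabla r x) > 0))"

definition has_lagrangian_psh_exhaustion ::
    "('x::topological_space, 'e::euclidean_space) chart set \<Rightarrow> ('x \<Rightarrow> 'e \<Rightarrow> 'e \<Rightarrow> real) \<Rightarrow>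
     ('x \<Rightarrow> 'e \<Rightarrow> 'e) \<Rightarrow> (('x \<Rightarrow> 'e) \<Rightarrow> ('x \<Rightarrow> 'e) \<Rightarrow> 'x \<Rightarrow> 'e) \<Rightarrow> 'x set \<Rightarrow> bool" where
  "has_lagrangian_psh_exhaustion A \<omega> J nabla \<Omega> \<longleftrightarrow>
     (\<exists>f. lagrangian_psh_on A \<omega> J nabla \<Omega> f \<and> (\<forall>a. compact {x\<in>\<Omega>. f x \<le> a}) \<and>
        (\<exists>K. compact K \<and> K \<subseteq> \<Omega> \<and> strictly_lagrangian_psh_on A \<omega> J nabla (\<Omega> - K) f))"

definition has_strict_lagrangian_psh_end_function ::
    "('x::topological_space, 'e::euclidean_space) chart set \<Rightarrow> ('x \<Rightarrow> 'e \<Rightarrow> 'e \<Rightarrow> real) \<Rightarrow>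
     ('x \<Rightarrow> 'e \<Rightarrow> 'e) \<Rightarrow> (('x \<Rightarrow> 'e) \<Rightarrow> ('x \<Rightarrow> 'e) \<Rightarrow> 'x \<Rightarrow> 'e) \<Rightarrow> 'x set \<Rightarrow> bool" where
  "has_strict_lagrangian_psh_end_function A \<omega> J nabla \<Omega> \<longleftrightarrow>
     (\<exists>K v. compact K \<and> K \<subseteq> \<Omega> \<and> strictly_lagrangian_psh_on A \<omega> J nabla (\<Omega> - K) v \<and>
        (\<forall>a. \<exists>L. compact L \<and> K \<subseteq> L \<and> L \<subseteq> \<Omega> \<and> (\<forall>x\<in>\<Omega> - L. v x > a)))"

text \<open>The two conditions are equivalent; both are demanded, so that neither is preferred.\<close>

definition strictly_lagrangian_convex_at_infinity ::
    "('x::topological_space, 'e::euclidean_space) chart set \<Rightarrow> ('x \<Rightarrow> 'e \<Rightarrow> 'e \<Rightarrow> real) \<Rightarrow>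
     ('x \<Rightarrow> 'e \<Rightarrow> 'e) \<Rightarrow> (('x \<Rightarrow> 'e) \<Rightarrow> ('x \<Rightarrow> 'e) \<Rightarrow> 'x \<Rightarrow> 'e) \<Rightarrow> 'x set \<Rightarrow> bool" where
  "strictly_lagrangian_convex_at_infinity A \<omega> J nabla \<Omega> \<longleftrightarrow>
     has_lagrangian_psh_exhaustion A \<omega> J nabla \<Omega> \<and>
     has_strict_lagrangian_psh_end_function A \<omega> J nabla \<Omega>"

end

theory Submission
  imports Defs
begin

text \<open>For a function \<open>f\<close> and a real function \<open>\<phi>\<close> one has
  \<open>Hess (\<phi> \<circ> f) = \<phi>'(f) Hess f + \<phi>''(f) df \<otimes> df\<close>. With \<open>\<delta> = - \<rho>\<close> this gives
  \<open>\<delta>\<^sup>2 tr\<^sub>W Hess (- log \<delta>) = \<delta> tr\<^sub>W Hess \<rho> + tr\<^sub>W (d\<rho> \<otimes> d\<rho>)\<close>. If the right-hand side were not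
  positive for Lagrangian planes \<open>W\<^sub>k\<close> at points \<open>x\<^sub>k \<in> \<Omega>\<close> with \<open>\<delta>(x\<^sub>k) \<rightarrow> 0\<close>, then, by compactness
  of the set of orthonormal frames, a subsequence of the \<open>W\<^sub>k\<close> would converge to a Lagrangian plane
  \<open>W \<subseteq> ker d\<rho>\<close> at a boundary point with \<open>tr\<^sub>W Hess \<rho> \<le> 0\<close>. This contradicts the convexity of the
  boundary, which does not depend on the defining function: where \<open>d\<rho> = \<kappa> dr\<close>, the forms
  \<open>Hess \<rho>\<close> and \<open>\<kappa> Hess r\<close> agree on the diagonal of \<open>ker d\<rho>\<close>. A plurisubharmonic exhaustion of
  all of \<open>\<Omega>\<close> is \<open>\<chi> (- log \<delta> - a)\<close>, where \<open>\<chi>\<close> is smooth, vanishes on \<open>t \<le> 0\<close>, and is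
  increasing and convex on \<open>t > 0\<close>.\<close>

section \<open>Calculus of smooth functions\<close>

text \<open>The obstacle is that \<open>Hess \<rho>\<close> is controlled only at boundary points
  and only on Lagrangian planes tangent to the boundary, whereas \<open>- log \<delta>\<close> must
  be tested at interior points on all Lagrangian planes. Tilted planes are saved by the square of
  \<open>d\<rho>\<close>, whose weight relative to \<open>Hess \<rho>\<close> is
  \<open>1 / \<delta>\<close>; an explicit threshold for the tilt is avoided by compactness.
  Compactness in turn needs neighbouring points to be comparable, although tangent vectors are
  stored in preferred charts that jump from point to point; hence the Hessian is shown to be a
  tensor with continuous coefficients in any fixed chart. Independence of the defining function is
  reached without dividing one defining function by another: second derivatives are compared along
  curves tangent to the boundary, and the resulting one-sided inequality suffices for a positive
  trace. The choice for \<chi> is \<open>t * exp (- 1 / t)\<close>; the factor \<open>t\<close>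
  gives convexity on the whole half-line and unbounded growth, which \<open>exp (- 1 / t)\<close>
  alone does not have.\<close>

lemma Ck_on_Suc_imp: "Ck_on (Suc k) S f \<Longrightarrow> Ck_on k S f"
proof (induction k arbitrary: f)
  case 0
  then show ?case
    by (auto intro!: differentiable_imp_continuous_on simp: differentiable_on_def differentiable_at_withinI)
next
  case (Suc k)
  then show ?case by (metis Ck_on.simps(2))
qed

lemma smooth_on_imp_continuous_on: "smooth_on S f \<Longrightarrow> continuous_on S f"
  unfolding smooth_on_def by (metis Ck_on.simps(1))

lemma smooth_on_imp_differentiable: "smooth_on S f \<Longrightarrow> x \<in> S \<Longrightarrow> f differentiable at x"
  unfolding smooth_on_def by (metis Ck_on.simps(2))

lemma smooth_on_imp_has_derivative:
  "smooth_on S f \<Longrightarrow> x \<in> S \<Longrightarrow> (f has_derivative frechet_derivative f (at x)) (at x)"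
  using smooth_on_imp_differentiable frechet_derivative_works by blast

lemma has_derivative_eq_frechet_derivative:
  "(f has_derivative D) (at x) \<Longrightarrow> D v = frechet_derivative f (at x) v"
  using frechet_derivative_at by metis

lemma smooth_on_derivative: "smooth_on S f \<Longrightarrow> smooth_on S (\<lambda>x. frechet_derivative f (at x) v)"
  unfolding smooth_on_def by (metis Ck_on.simps(2))

text \<open>Functions with the same germ at \<open>x\<close> admit the same derivatives, so the
  choice hidden in \<open>frechet_derivative\<close> falls on the same map even where neither
  function is differentiable. Hence \<open>differential_cong\<close> below carries no smoothness
  assumption.\<close>

lemma frechet_derivative_cong_open:
  assumes "open S" "x \<in> S" "\<And>y. y \<in> S \<Longrightarrow> f y = g y"
  shows "frechet_derivative f (at x) = frechet_derivative g (at x)"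
proof -
  have "(f has_derivative D) (at x) \<longleftrightarrow> (g has_derivative D) (at x)" for D
    using has_derivative_transform_within_open[OF _ assms(1,2)] assms(3) by metis
  then show ?thesis by (simp add: frechet_derivative_def)
qed

lemma differentiable_cong_open:
  assumes "open S" "x \<in> S" "\<And>y. y \<in> S \<Longrightarrow> f y = g y" "f differentiable at x"
  shows "g differentiable at x"
  using assms has_derivative_transform_within_open[OF _ assms(1,2)]
  unfolding differentiable_def by metis

text \<open>The rules of calculus identify \<open>frechet_derivative\<close> with a formula only at
  points of \<open>S\<close>; this lemma lets the formula replace it in the inductions on
  \<open>k\<close>.\<close>

lemma Ck_on_cong:
  assumes "open S" "\<And>x. x \<in> S \<Longrightarrow> f x = g x" "Ck_on k S f"
  shows "Ck_on k S g"
  using assms(2,3)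
proof (induction k arbitrary: f g)
  case 0
  then show ?case by (simp cong: continuous_on_cong)
next
  case (Suc k)
  have "frechet_derivative f (at x) = frechet_derivative g (at x)" if "x \<in> S" for x
    using frechet_derivative_cong_open[OF assms(1) that, of f g] Suc.prems(1) by blast
  then have "Ck_on k S (\<lambda>x. frechet_derivative g (at x) v)" for v
    using Suc.IH[of "\<lambda>x. frechet_derivative f (at x) v" "\<lambda>x. frechet_derivative g (at x) v"] Suc.prems(2)
    by simp
  moreover have "g differentiable at x" if "x \<in> S" for x
    using differentiable_cong_open[OF assms(1) that, of f g] Suc.prems that by simp
  ultimately show ?case by simp
qed

lemma smooth_on_cong:
  assumes "open S" "\<And>x. x \<in> S \<Longrightarrow> f x = g x" "smooth_on S f"
  shows "smooth_on S g"
  using assms(3) unfolding smooth_on_def by (blast intro: Ck_on_cong[OF assms(1), of f g, OF assms(2)])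

lemma smooth_on_subset: "smooth_on S f \<Longrightarrow> T \<subseteq> S \<Longrightarrow> smooth_on T f"
proof -
  have "Ck_on k T f" if "Ck_on k S f" "T \<subseteq> S" for k
    using that by (induction k arbitrary: f) (auto intro: continuous_on_subset)
  then show "smooth_on S f \<Longrightarrow> T \<subseteq> S \<Longrightarrow> smooth_on T f" by (auto simp: smooth_on_def)
qed

lemma smooth_on_const: "smooth_on S (\<lambda>x. a)"
proof -
  have "Ck_on k S (\<lambda>x. a)" for k
    by (induction k arbitrary: a) simp_all
  then show ?thesis by (simp add: smooth_on_def)
qed

lemma Ck_on_add:
  assumes "open S" "Ck_on k S f" "Ck_on k S g"
  shows "Ck_on k S (\<lambda>x. f x + g x)"
  using assms(2,3)
proof (induction k arbitrary: f g)
  case 0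
  then show ?case by (simp add: continuous_on_add)
next
  case (Suc k)
  have "Ck_on k S (\<lambda>x. frechet_derivative (\<lambda>x. f x + g x) (at x) v)" for v
  proof (rule Ck_on_cong[OF assms(1)])
    show "Ck_on k S (\<lambda>x. frechet_derivative f (at x) v + frechet_derivative g (at x) v)"
      using Suc by simp
    show "frechet_derivative f (at x) v + frechet_derivative g (at x) v =
      frechet_derivative (\<lambda>x. f x + g x) (at x) v" if "x \<in> S" for x
    proof -
      have "(f has_derivative frechet_derivative f (at x)) (at x)"
        "(g has_derivative frechet_derivative g (at x)) (at x)"
        using Suc.prems that by (metis Ck_on.simps(2) frechet_derivative_works)+
      from has_derivative_add[OF this] show ?thesis by (rule has_derivative_eq_frechet_derivative)
    qed
  qed
  with Suc show ?case by simp
qed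

lemma smooth_on_add:
  "open S \<Longrightarrow> smooth_on S f \<Longrightarrow> smooth_on S g \<Longrightarrow> smooth_on S (\<lambda>x. f x + g x)"
  by (simp add: smooth_on_def Ck_on_add)

lemma Ck_on_sum:
  assumes "open S" "\<And>i. i \<in> I \<Longrightarrow> Ck_on k S (f i)"
  shows "Ck_on k S (\<lambda>x. \<Sum>i\<in>I. f i x)"
  using assms(2)
proof (induction I rule: infinite_finite_induct)
  case (insert i I)
  then show ?case using Ck_on_add[OF assms(1), of k "f i"] by simp
qed (use smooth_on_const[of S] in \<open>auto simp: smooth_on_def\<close>)

lemma smooth_on_sum:
  "open S \<Longrightarrow> (\<And>i. i \<in> I \<Longrightarrow> smooth_on S (f i)) \<Longrightarrow> smooth_on S (\<lambda>x. \<Sum>i\<in>I. f i x)"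
  by (simp add: smooth_on_def Ck_on_sum)

lemma Ck_on_scaleR:
  fixes f :: "'a::euclidean_space \<Rightarrow> real" and g :: "'a \<Rightarrow> 'b::real_normed_vector"
  assumes "open S" "Ck_on k S f" "Ck_on k S g"
  shows "Ck_on k S (\<lambda>x. f x *\<^sub>R g x)"
  using assms(2,3)
proof (induction k arbitrary: f g)
  case 0
  then show ?case by (simp add: continuous_on_scaleR)
next
  case (Suc k)
  have "Ck_on k S (\<lambda>x. frechet_derivative (\<lambda>x. f x *\<^sub>R g x) (at x) v)" for v
  proof (rule Ck_on_cong[OF assms(1)])
    show "Ck_on k S (\<lambda>x. f x *\<^sub>R frechet_derivative g (at x) v + frechet_derivative f (at x) v *\<^sub>R g x)"
      using Suc.prems Ck_on_Suc_imp[OF Suc.prems(1)] Ck_on_Suc_imp[OF Suc.prems(2)]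
      by (intro Ck_on_add Suc.IH assms(1)) simp_all
    show "f x *\<^sub>R frechet_derivative g (at x) v + frechet_derivative f (at x) v *\<^sub>R g x =
      frechet_derivative (\<lambda>x. f x *\<^sub>R g x) (at x) v" if "x \<in> S" for x
    proof -
      have "(f has_derivative frechet_derivative f (at x)) (at x)"
        "(g has_derivative frechet_derivative g (at x)) (at x)"
        using Suc.prems that by (metis Ck_on.simps(2) frechet_derivative_works)+
      from has_derivative_scaleR[OF this] show ?thesis by (rule has_derivative_eq_frechet_derivative)
    qed
  qed
  moreover have "(\<lambda>x. f x *\<^sub>R g x) differentiable at x" if "x \<in> S" for x
    using Suc.prems that by (auto intro!: differentiable_scaleR)
  ultimately show ?case by simp
qed

lemma smooth_on_scaleR:
  fixes f :: "'a::euclidean_space \<Rightarrow> real"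
  shows "open S \<Longrightarrow> smooth_on S f \<Longrightarrow> smooth_on S g \<Longrightarrow> smooth_on S (\<lambda>x. f x *\<^sub>R g x)"
  by (simp add: smooth_on_def Ck_on_scaleR)

lemma smooth_on_mult:
  fixes f g :: "'a::euclidean_space \<Rightarrow> real"
  shows "open S \<Longrightarrow> smooth_on S f \<Longrightarrow> smooth_on S g \<Longrightarrow> smooth_on S (\<lambda>x. f x * g x)"
  using smooth_on_scaleR[of S f g] by simp

lemma Ck_on_bounded_linear:
  assumes "open S" "bounded_linear h" "Ck_on k S f"
  shows "Ck_on k S (\<lambda>x. h (f x))"
  using assms(3)
proof (induction k arbitrary: f)
  case 0
  then show ?case using bounded_linear.continuous_on[OF assms(2)] by simp
next
  case (Suc k)
  have h: "((\<lambda>x. h (f x)) has_derivative (\<lambda>v. h (frechet_derivative f (at x) v))) (at x)" if "x \<in> S" for x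
    using Suc.prems that bounded_linear.has_derivative[OF assms(2)] frechet_derivative_works
    by (metis Ck_on.simps(2))
  have "Ck_on k S (\<lambda>x. frechet_derivative (\<lambda>x. h (f x)) (at x) v)" for v
  proof (rule Ck_on_cong[OF assms(1)])
    show "Ck_on k S (\<lambda>x. h (frechet_derivative f (at x) v))"
      using Suc by simp
    show "h (frechet_derivative f (at x) v) = frechet_derivative (\<lambda>x. h (f x)) (at x) v"
      if "x \<in> S" for x
      using h[OF that] by (rule has_derivative_eq_frechet_derivative)
  qed
  with h show ?case by (auto simp: differentiable_def)
qed

lemma smooth_on_bounded_linear:
  "open S \<Longrightarrow> bounded_linear h \<Longrightarrow> smooth_on S f \<Longrightarrow> smooth_on S (\<lambda>x. h (f x))"
  by (simp add: smooth_on_def Ck_on_bounded_linear)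

lemma smooth_on_inner: "open S \<Longrightarrow> smooth_on S f \<Longrightarrow> smooth_on S (\<lambda>x. f x \<bullet> b)"
  using smooth_on_bounded_linear[OF _ bounded_linear_inner_left] .

lemma linear_euclidean_expansion:
  fixes L :: "'a::euclidean_space \<Rightarrow> 'b::real_vector"
  assumes "linear L"
  shows "L u = (\<Sum>b\<in>Basis. (u \<bullet> b) *\<^sub>R L b)"
proof -
  have "L u = L (\<Sum>b\<in>Basis. (u \<bullet> b) *\<^sub>R b)" by (simp add: euclidean_representation)
  then show ?thesis by (simp add: linear_sum[OF assms] linear_scale[OF assms])
qed

lemma linear_frechet_derivative: "f differentiable at x \<Longrightarrow> linear (frechet_derivative f (at x))"
  using frechet_derivative_works has_derivative_linear by blast

text \<open>In the chain rule the outer derivative is taken in a direction that moves with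
  \<open>x\<close>, while \<open>Ck_on\<close> speaks of fixed directions. Expanding that direction
  in the basis leaves outer derivatives in fixed directions, to which the induction hypothesis
  applies.\<close>

lemma Ck_on_compose:
  fixes f :: "'a::euclidean_space \<Rightarrow> 'b::euclidean_space"
  assumes "open S" "Ck_on k S f" "Ck_on k T g" "f ` S \<subseteq> T"
  shows "Ck_on k S (\<lambda>x. g (f x))"
  using assms(2,3)
proof (induction k arbitrary: g)
  case 0
  then show ?case using assms(4) continuous_on_compose2 by (metis Ck_on.simps(1))
next
  case (Suc k)
  have d: "((\<lambda>x. g (f x)) has_derivative
      (\<lambda>v. frechet_derivative g (at (f x)) (frechet_derivative f (at x) v))) (at x)" if "x \<in> S" for x
  proof -
    have f: "(f has_derivative frechet_derivative f (at x)) (at x)"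
      using Suc.prems that by (metis Ck_on.simps(2) frechet_derivative_works)
    have "f x \<in> T" using that assms(4) by auto
    then have "(g has_derivative frechet_derivative g (at (f x))) (at (f x))"
      using Suc.prems by (metis Ck_on.simps(2) frechet_derivative_works)
    from has_derivative_compose[OF f this] show ?thesis .
  qed
  have "Ck_on k S (\<lambda>x. frechet_derivative (\<lambda>x. g (f x)) (at x) v)" for v
  proof (rule Ck_on_cong[OF assms(1)])
    show "Ck_on k S (\<lambda>x. \<Sum>b\<in>Basis. (frechet_derivative f (at x) v \<bullet> b) *\<^sub>R frechet_derivative g (at (f x)) b)"
    proof (intro Ck_on_sum Ck_on_scaleR assms(1))
      show "Ck_on k S (\<lambda>x. frechet_derivative f (at x) v \<bullet> b)" for b
        using Suc.prems by (intro Ck_on_bounded_linear[OF assms(1) bounded_linear_inner_left]) simp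
      show "Ck_on k S (\<lambda>x. frechet_derivative g (at (f x)) b)" for b
        using Suc.prems Ck_on_Suc_imp[OF Suc.prems(1)] by (intro Suc.IH) simp_all
    qed
    show "(\<Sum>b\<in>Basis. (frechet_derivative f (at x) v \<bullet> b) *\<^sub>R frechet_derivative g (at (f x)) b) =
      frechet_derivative (\<lambda>x. g (f x)) (at x) v" if "x \<in> S" for x
    proof -
      have "g differentiable at (f x)" using that Suc.prems(2) assms(4) by auto
      from linear_euclidean_expansion[OF linear_frechet_derivative[OF this]]
      have "frechet_derivative g (at (f x)) (frechet_derivative f (at x) v) =
        (\<Sum>b\<in>Basis. (frechet_derivative f (at x) v \<bullet> b) *\<^sub>R frechet_derivative g (at (f x)) b)" .
      then show ?thesis using has_derivative_eq_frechet_derivative[OF d[OF that]] by simp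
    qed
  qed
  with d show ?case by (auto simp: differentiable_def)
qed

lemma smooth_on_compose:
  fixes f :: "'a::euclidean_space \<Rightarrow> 'b::euclidean_space"
  shows "open S \<Longrightarrow> smooth_on S f \<Longrightarrow> smooth_on T g \<Longrightarrow> f ` S \<subseteq> T \<Longrightarrow> smooth_on S (\<lambda>x. g (f x))"
  unfolding smooth_on_def using Ck_on_compose by blast

lemma smooth_on_derivative_field:
  fixes f :: "'a::euclidean_space \<Rightarrow> 'b::real_normed_vector"
  assumes "open S" "smooth_on S f" "smooth_on S V"
  shows "smooth_on S (\<lambda>x. frechet_derivative f (at x) (V x))"
proof (rule smooth_on_cong[OF assms(1)])
  show "smooth_on S (\<lambda>x. \<Sum>b\<in>Basis. (V x \<bullet> b) *\<^sub>R frechet_derivative f (at x) b)"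
    using assms by (intro smooth_on_sum smooth_on_scaleR smooth_on_inner smooth_on_derivative)
  show "(\<Sum>b\<in>Basis. (V x \<bullet> b) *\<^sub>R frechet_derivative f (at x) b) = frechet_derivative f (at x) (V x)"
    if "x \<in> S" for x
    by (rule linear_euclidean_expansion[OF linear_frechet_derivative
          [OF smooth_on_imp_differentiable[OF assms(2) that]], symmetric])
qed

lemma Ck_on_real_SucI:
  fixes f :: "real \<Rightarrow> real"
  assumes "open S" "\<And>x. x \<in> S \<Longrightarrow> (f has_real_derivative f' x) (at x)" "Ck_on k S f'"
  shows "Ck_on (Suc k) S f"
proof -
  have "f differentiable at x" if "x \<in> S" for x
    unfolding real_differentiable_def using assms(2)[OF that] by (rule exI)
  moreover have "Ck_on k S (\<lambda>x. frechet_derivative f (at x) v)" for v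
  proof (rule Ck_on_cong[OF assms(1) _ Ck_on_bounded_linear[OF assms(1) bounded_linear_mult_left[of v] assms(3)]])
    show "f' x * v = frechet_derivative f (at x) v" if "x \<in> S" for x
      using assms(2)[OF that] has_derivative_eq_frechet_derivative[of f "(*) (f' x)" x v]
      by (simp add: has_field_derivative_def)
  qed
  ultimately show ?thesis by simp
qed

lemma smooth_on_id: "smooth_on S (\<lambda>x. x)"
proof -
  have "Ck_on k S (\<lambda>x. x)" for k
    by (cases k) (simp_all add: smooth_on_const[unfolded smooth_on_def, rule_format])
  then show ?thesis by (simp add: smooth_on_def)
qed

text \<open>The derivative is minus the square of the function itself, so the induction closes. The
  negative half-line is where a defining function takes its values inside the domain.\<close>

lemma smooth_on_inverse: "smooth_on {t::real. t < 0} inverse"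
proof -
  have o: "open {t::real. t < 0}" by (simp add: open_lessThan flip: lessThan_def)
  have "Ck_on k {t::real. t < 0} inverse" for k
  proof (induction k)
    case 0
    then show ?case by (auto intro!: continuous_intros)
  next
    case (Suc k)
    have "Ck_on k {t::real. t < 0} (\<lambda>t. inverse t *\<^sub>R inverse t)"
      using Suc by (intro Ck_on_scaleR o)
    from Ck_on_bounded_linear[OF o bounded_linear_minus[OF bounded_linear_ident] this]
    show ?case
      by (rule Ck_on_real_SucI[OF o, rotated]) (auto intro!: derivative_eq_intros)
  qed
  then show ?thesis by (simp add: smooth_on_def)
qed

lemma smooth_on_minus_ln_minus: "smooth_on {t::real. t < 0} (\<lambda>t. - ln (- t))"
proof -
  have o: "open {t::real. t < 0}" by (simp add: open_lessThan flip: lessThan_def)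
  have "Ck_on k {t::real. t < 0} (\<lambda>t. - inverse t)" for k
    using smooth_on_inverse Ck_on_bounded_linear[OF o bounded_linear_minus[OF bounded_linear_ident], of k inverse]
    by (simp add: smooth_on_def)
  moreover have "((\<lambda>t. - ln (- t)) has_real_derivative - inverse t) (at t)" if "t < 0" for t :: real
    using that by (auto intro!: derivative_eq_intros simp: field_simps)
  ultimately have "Ck_on (Suc k) {t::real. t < 0} (\<lambda>t. - ln (- t))" for k
    by (intro Ck_on_real_SucI[OF o, of _ "\<lambda>t. - inverse t"]) simp_all
  from Ck_on_Suc_imp[OF this] show ?thesis by (simp add: smooth_on_def)
qed

section \<open>A smooth convex function vanishing on the negative half-line\<close>

text \<open>The exponent \<open>n\<close> is there because the derivatives of
  \<open>exp (- 1 / t)\<close> acquire powers of \<open>t\<close> in the denominator; the whole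
  family is closed under linear combinations of derivatives, and one induction treats all exponents
  at once.\<close>

definition flat :: "nat \<Rightarrow> real \<Rightarrow> real" where
  "flat n t = (if t > 0 then exp (- (1 / t)) / t ^ n else 0)"

text \<open>Under \<open>x = 1 / h\<close> this is the decay of \<open>x ^ n / exp x\<close> at
  infinity.\<close>

lemma flat_div_tendsto: "((\<lambda>h::real. exp (- (1 / h)) / h ^ n) \<longlongrightarrow> 0) (at_right 0)"
proof -
  have "((\<lambda>x::real. x ^ n / exp x) \<longlongrightarrow> 0) at_top"
    by (rule tendsto_power_div_exp_0)
  from filterlim_compose[OF this filterlim_inverse_at_top_right]
  show ?thesis
    by (simp add: exp_minus field_simps power_inverse inverse_eq_divide)
qed

lemma flat_has_derivative:
  "(flat n has_real_derivative (flat (n + 2) t - n * flat (n + 1) t)) (at t)"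
proof -
  consider "t < 0" | "t = 0" | "t > 0" by linarith
  then show ?thesis
  proof cases
    case 1
    have "((\<lambda>t. 0) has_real_derivative 0) (at t)" by simp
    then have "(flat n has_real_derivative 0) (at t)"
      by (rule DERIV_cong_ev[THEN iffD1, rotated -1, OF _ refl _ refl])
        (use 1 in \<open>auto simp: flat_def eventually_at_filter intro!: eventually_mono[OF eventually_nhds_in_open[of "{..<0}"]]\<close>)
    with 1 show ?thesis by (simp add: flat_def)
  next
    case 2
    \<comment> \<open>For \<open>h > 0\<close> the difference quotient is
      \<open>exp (- (1 / h)) / h ^ Suc n\<close>, so the decay with the next exponent
      applies.\<close>
    have R: "((\<lambda>h. flat n h / h) \<longlongrightarrow> 0) (at_right 0)"
      using flat_div_tendsto[of "Suc n"]
      by (rule Lim_transform_eventually)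
        (auto simp: flat_def eventually_at_right_less intro!: eventually_mono[OF eventually_at_right_less])
    have L: "((\<lambda>h. flat n h / h) \<longlongrightarrow> 0) (at_left 0)"
      by (rule Lim_transform_eventually[OF tendsto_const])
        (auto simp: flat_def eventually_at_filter)
    have "((\<lambda>h. flat n h / h) \<longlongrightarrow> 0) (at 0)"
      using L R by (rule filterlim_split_at)
    then show ?thesis using 2 by (simp add: DERIV_def flat_def)
  next
    case 3
    have "((\<lambda>t. exp (- (1 / t)) / t ^ n) has_real_derivative
        (exp (- (1 / t)) / t ^ (n + 2) - n * (exp (- (1 / t)) / t ^ (n + 1)))) (at t)"
    proof -
      have "((\<lambda>t. exp (- (1 / t))) has_real_derivative exp (- (1 / t)) / t ^ 2) (at t)"
        using 3 by (auto intro!: derivative_eq_intros simp: power2_eq_square)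
      from DERIV_divide[OF this DERIV_pow[of n t]] 3 show ?thesis
        by (cases n) (auto elim!: DERIV_cong simp: field_simps power2_eq_square)
    qed
    then have "(flat n has_real_derivative
        (exp (- (1 / t)) / t ^ (n + 2) - n * (exp (- (1 / t)) / t ^ (n + 1)))) (at t)"
      by (rule DERIV_cong_ev[THEN iffD1, rotated -1, OF _ refl _ refl])
        (use 3 in \<open>auto simp: flat_def eventually_at_filter intro!: eventually_mono[OF eventually_nhds_in_open[of "{0<..}"]]\<close>)
    with 3 show ?thesis by (simp add: flat_def)
  qed
qed

lemma smooth_on_flat: "smooth_on UNIV (flat n)"
proof -
  have "Ck_on k UNIV (flat n)" for k
  proof (induction k arbitrary: n)
    case 0
    show ?case
      using DERIV_isCont[OF flat_has_derivative] by (simp add: continuous_on_eq_continuous_at)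
  next
    case (Suc k)
    have "Ck_on k UNIV (\<lambda>t. - (real n * flat (n + 1) t))"
      using Ck_on_bounded_linear[OF open_UNIV bounded_linear_minus[OF bounded_linear_mult_right[of "real n"]] Suc[of "n + 1"]] .
    with Suc[of "n + 2"] have "Ck_on k UNIV (\<lambda>t. flat (n + 2) t + - (real n * flat (n + 1) t))"
      by (rule Ck_on_add[OF open_UNIV])
    then show ?case
      using Ck_on_real_SucI[OF open_UNIV flat_has_derivative[of n], of k] by simp
  qed
  then show ?thesis by (simp add: smooth_on_def)
qed

text \<open>\<open>exp (- 1 / t)\<close> alone is bounded and convex only for
  \<open>t \<le> 1 / 2\<close>. With the factor \<open>t\<close> the growth is linear, and the first
  two derivatives collapse to \<open>flat 0 + flat 1\<close> and \<open>flat 3\<close>, both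
  positive for \<open>t > 0\<close>.\<close>

definition convex_cutoff :: "real \<Rightarrow> real" where
  "convex_cutoff t = t * flat 0 t"

lemma smooth_on_convex_cutoff: "smooth_on UNIV convex_cutoff"
  using smooth_on_mult[OF open_UNIV smooth_on_id smooth_on_flat[of 0]]
  by (simp add: convex_cutoff_def[abs_def])

lemma convex_cutoff_has_derivative:
  "(convex_cutoff has_real_derivative flat 0 t + flat 1 t) (at t)"
proof -
  have "(convex_cutoff has_real_derivative flat 0 t + flat 2 t * t) (at t)"
    unfolding convex_cutoff_def[abs_def]
    using flat_has_derivative[of 0 t] by (auto intro!: derivative_eq_intros simp: numeral_2_eq_2)
  moreover have "flat 2 t * t = flat 1 t" by (simp add: flat_def power2_eq_square)
  ultimately show ?thesis by simp
qed

lemma convex_cutoff_has_second_derivative: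
  "((\<lambda>t. flat 0 t + flat 1 t) has_real_derivative flat 3 t) (at t)"
  using DERIV_add[OF flat_has_derivative[of 0 t] flat_has_derivative[of 1 t]]
  by (simp add: numeral_2_eq_2 numeral_3_eq_3)

text \<open>This growth is what makes the sublevel sets of the exhaustion function compact.\<close>

lemma convex_cutoff_ge:
  assumes "t \<ge> 1"
  shows "t * exp (- 1) \<le> convex_cutoff t"
  using assms by (simp add: convex_cutoff_def flat_def)

text \<open>Vanishing at 0 with negative derivative, \<open>\<phi>'\<close> is negative just to the
  right of 0; the mean value theorem passes the sign on to \<open>\<phi>\<close>.\<close>

lemma second_order_negative:
  fixes \<phi> \<phi>' :: "real \<Rightarrow> real"
  assumes "e > 0" "\<And>t. \<bar>t\<bar> < e \<Longrightarrow> (\<phi> has_real_derivative \<phi>' t) (at t)"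
    and "(\<phi>' has_real_derivative a) (at 0)" "\<phi> 0 = 0" "\<phi>' 0 = 0" "a < 0"
  shows "\<exists>d>0. \<forall>t. 0 < t \<and> t < d \<longrightarrow> \<phi> t < 0"
proof -
  obtain d where d: "d > 0" "\<And>h. 0 < h \<Longrightarrow> h < d \<Longrightarrow> \<phi>' h < 0"
    using DERIV_neg_dec_right[OF assms(3,6)] assms(5) by auto
  have "\<phi> t < 0" if "0 < t" "t < min d e" for t
  proof -
    obtain z where "0 < z" "z < t" "\<phi> t - \<phi> 0 = (t - 0) * \<phi>' z"
    proof -
      have "(\<phi> has_real_derivative \<phi>' x) (at x)" if "0 \<le> x" "x \<le> t" for x
        using assms(2)[of x] that \<open>t < min d e\<close> by simp
      from MVT2[OF \<open>0 < t\<close> this] show ?thesis using that by blast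
    qed
    with d(2)[of z] that assms(4) show ?thesis by (simp add: mult_pos_neg)
  qed
  then show ?thesis using assms(1) d(1) by (intro exI[of _ "min d e"]) auto
qed

section \<open>Functions and fields in charts\<close>

locale smooth_manifold =
  fixes A :: "('x::{t2_space,second_countable_topology}, 'e::euclidean_space) chart set"
  assumes atlas: "smooth_atlas A"
begin

lemma homeomorphism_chart: "c \<in> A \<Longrightarrow> homeomorphism (fst c) (snd c ` fst c) (snd c) (param c)"
  using atlas by (auto simp: smooth_atlas_def)

lemma open_chart_domain: "c \<in> A \<Longrightarrow> open (fst c)"
  using atlas by (auto simp: smooth_atlas_def)

lemma chart_at_in_atlas: "chart_at A x \<in> A" and in_chart_at: "x \<in> fst (chart_at A x)"
proof -
  have "x \<in> (\<Union>c\<in>A. fst c)" using atlas by (simp add: smooth_atlas_def)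
  then have "\<exists>c. c \<in> A \<and> x \<in> fst c" by blast
  from someI_ex[OF this] show "chart_at A x \<in> A" "x \<in> fst (chart_at A x)"
    by (auto simp: chart_at_def)
qed

lemma param_chart: "c \<in> A \<Longrightarrow> x \<in> fst c \<Longrightarrow> param c (snd c x) = x"
  using homeomorphism_chart homeomorphism_apply1 by blast

lemma open_chart_image:
  assumes "c \<in> A" "open U"
  shows "open (snd c ` (fst c \<inter> U))"
proof -
  have "openin (top_of_set (fst c)) (fst c \<inter> U)" using assms by (simp add: openin_open_Int)
  from homeomorphism_imp_open_map[OF homeomorphism_chart[OF assms(1)] this]
  show ?thesis using assms(1) atlas openin_open_trans by (metis smooth_atlas_def)
qed

text \<open>Chart differentials and coordinate fields are both transition Jacobians, from and to the
  preferred chart; all identities between them thus reduce to the cocycle rule for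
  \<open>jac\<close>.\<close>

definition jac :: "('x, 'e) chart \<Rightarrow> ('x, 'e) chart \<Rightarrow> 'x \<Rightarrow> 'e \<Rightarrow> 'e" where
  "jac c d x = frechet_derivative (snd d \<circ> param c) (at (snd c x))"

lemma chart_diff_jac: "chart_diff A c x v = jac (chart_at A x) c x v"
  by (simp add: chart_diff_def jac_def)

lemma coord_field_jac: "coord_field A c u x = jac c (chart_at A x) x u"
  by (simp add: coord_field_def jac_def)

lemma smooth_transition:
  "c \<in> A \<Longrightarrow> d \<in> A \<Longrightarrow> smooth_on (snd c ` (fst c \<inter> fst d)) (snd d \<circ> param c)"
  using atlas by (auto simp: smooth_atlas_def)

lemma jac_has_derivative:
  assumes "c \<in> A" "d \<in> A" "x \<in> fst c" "x \<in> fst d"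
  shows "((snd d \<circ> param c) has_derivative jac c d x) (at (snd c x))"
  unfolding jac_def using assms by (intro smooth_on_imp_has_derivative[OF smooth_transition]) auto

lemma linear_jac: "c \<in> A \<Longrightarrow> d \<in> A \<Longrightarrow> x \<in> fst c \<Longrightarrow> x \<in> fst d \<Longrightarrow> linear (jac c d x)"
  using jac_has_derivative has_derivative_linear by blast

lemma derivative_change_chart:
  assumes "c \<in> A" "d \<in> A" "x \<in> fst c" "x \<in> fst d"
    and "((h \<circ> param d) has_derivative D) (at (snd d x))"
  shows "((h \<circ> param c) has_derivative (\<lambda>v. D (jac c d x v))) (at (snd c x))"
proof -
  have "((h \<circ> param d) has_derivative D) (at ((snd d \<circ> param c) (snd c x)))"
    using assms by (simp add: param_chart)
  from has_derivative_compose[OF jac_has_derivative[OF assms(1-4)] this]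
  show ?thesis
  proof (rule has_derivative_transform_within_open)
    show "open (snd c ` (fst c \<inter> fst d))" using assms by (simp add: open_chart_image open_chart_domain)
    show "snd c x \<in> snd c ` (fst c \<inter> fst d)" using assms by auto
    show "(h \<circ> param d) ((snd d \<circ> param c) q) = (h \<circ> param c) q"
      if "q \<in> snd c ` (fst c \<inter> fst d)" for q
      using that assms by (auto simp: param_chart)
  qed
qed

lemma jac_self:
  assumes "c \<in> A" "x \<in> fst c"
  shows "jac c c x v = v"
proof -
  have "((\<lambda>q. q) has_derivative (\<lambda>v. v)) (at (snd c x))" by (rule has_derivative_ident)
  then have "((snd c \<circ> param c) has_derivative (\<lambda>v. v)) (at (snd c x))"
    by (rule has_derivative_transform_within_open[OF _ open_chart_image[OF assms(1) open_chart_domain[OF assms(1)]]])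
      (use assms in \<open>auto simp: param_chart\<close>)
  from has_derivative_eq_frechet_derivative[OF this, of v] show ?thesis by (simp add: jac_def)
qed

lemma jac_cocycle:
  assumes "c \<in> A" "d \<in> A" "e \<in> A" "x \<in> fst c" "x \<in> fst d" "x \<in> fst e"
  shows "jac d e x (jac c d x v) = jac c e x v"
  using has_derivative_eq_frechet_derivative
    [OF derivative_change_chart[OF assms(1,2,4,5) jac_has_derivative[OF assms(2,3,5,6)]], of v]
  by (simp add: jac_def)

lemma chart_diff_coord_field:
  "c \<in> A \<Longrightarrow> d \<in> A \<Longrightarrow> x \<in> fst c \<Longrightarrow> x \<in> fst d \<Longrightarrow>
    chart_diff A d x (coord_field A c u x) = jac c d x u"
  by (simp add: chart_diff_jac coord_field_jac jac_cocycle chart_at_in_atlas in_chart_at)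

lemma chart_diff_coord_field_self:
  "c \<in> A \<Longrightarrow> x \<in> fst c \<Longrightarrow> chart_diff A c x (coord_field A c u x) = u"
  by (simp add: chart_diff_coord_field jac_self)

lemma coord_field_chart_diff:
  "c \<in> A \<Longrightarrow> x \<in> fst c \<Longrightarrow> coord_field A c (chart_diff A c x v) x = v"
  by (simp add: chart_diff_jac coord_field_jac jac_cocycle jac_self chart_at_in_atlas in_chart_at)

lemma chart_diff_chart_at: "chart_diff A (chart_at A x) x v = v"
  by (simp add: chart_diff_jac jac_self chart_at_in_atlas in_chart_at)

lemma coord_field_chart_at: "coord_field A (chart_at A x) v x = v"
  by (simp add: coord_field_jac jac_self chart_at_in_atlas in_chart_at)

lemma linear_chart_diff: "c \<in> A \<Longrightarrow> x \<in> fst c \<Longrightarrow> linear (chart_diff A c x)"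
  using linear_jac[of "chart_at A x" c x] chart_at_in_atlas in_chart_at
  by (simp add: chart_diff_jac[abs_def])

lemma linear_coord_field: "c \<in> A \<Longrightarrow> x \<in> fst c \<Longrightarrow> linear (\<lambda>u. coord_field A c u x)"
  using linear_jac[of c "chart_at A x" x] chart_at_in_atlas in_chart_at
  by (simp add: coord_field_jac[abs_def])

lemma vector_expansion:
  assumes "c \<in> A" "x \<in> fst c"
  shows "v = (\<Sum>b\<in>Basis. (chart_diff A c x v \<bullet> b) *\<^sub>R coord_field A c b x)"
  using linear_euclidean_expansion[OF linear_coord_field[OF assms], of "chart_diff A c x v"] assms
  by (simp add: coord_field_chart_diff)

lemma smooth_fun_on_has_derivative:
  assumes "smooth_fun_on A U f" "c \<in> A" "x \<in> fst c" "x \<in> U"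
  shows "((f \<circ> param c) has_derivative frechet_derivative (f \<circ> param c) (at (snd c x))) (at (snd c x))"
  using assms by (intro smooth_on_imp_has_derivative[of "snd c ` (fst c \<inter> U)"]) (auto simp: smooth_fun_on_def)

lemma differential_has_derivative:
  assumes "smooth_fun_on A U f" "x \<in> U"
  shows "((f \<circ> param (chart_at A x)) has_derivative differential A f x) (at (snd (chart_at A x) x))"
  using smooth_fun_on_has_derivative[OF assms(1) chart_at_in_atlas in_chart_at assms(2)]
  by (simp add: differential_def[abs_def])

lemma differentialI:
  "((f \<circ> param (chart_at A x)) has_derivative D) (at (snd (chart_at A x) x)) \<Longrightarrow> differential A f x v = D v"
  by (simp add: differential_def has_derivative_eq_frechet_derivative)

lemma differential_chart:
  assumes "smooth_fun_on A U f" "c \<in> A" "x \<in> fst c" "x \<in> U"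
  shows "differential A f x v = frechet_derivative (f \<circ> param c) (at (snd c x)) (chart_diff A c x v)"
  unfolding chart_diff_jac
  using derivative_change_chart[OF chart_at_in_atlas assms(2) in_chart_at assms(3)
      smooth_fun_on_has_derivative[OF assms]]
  by (rule differentialI)

lemma linear_differential: "smooth_fun_on A U f \<Longrightarrow> x \<in> U \<Longrightarrow> linear (differential A f x)"
  using differential_has_derivative has_derivative_linear by blast

lemma differential_cong:
  assumes "open U" "x \<in> U" "\<And>y. y \<in> U \<Longrightarrow> f y = g y"
  shows "differential A f x v = differential A g x v"
  unfolding differential_def
  by (subst frechet_derivative_cong_open[OF open_chart_image[OF chart_at_in_atlas assms(1)], of _ _ _ "g \<circ> param (chart_at A x)"])
    (use assms in \<open>auto simp: param_chart chart_at_in_atlas in_chart_at\<close>)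

lemma differential_add:
  assumes "smooth_fun_on A U f" "smooth_fun_on A U g" "x \<in> U"
  shows "differential A (\<lambda>y. f y + g y) x v = differential A f x v + differential A g x v"
  using has_derivative_add[OF assms(1,2)[THEN differential_has_derivative, OF assms(3)]]
  by (intro differentialI[where D = "\<lambda>v. differential A f x v + differential A g x v"]) (simp add: o_def)

lemma differential_mult:
  assumes "smooth_fun_on A U f" "smooth_fun_on A U g" "x \<in> U"
  shows "differential A (\<lambda>y. f y * g y) x v = f x * differential A g x v + differential A f x v * g x"
  using has_derivative_mult[OF assms(1,2)[THEN differential_has_derivative, OF assms(3)]]
  by (intro differentialI[where D = "\<lambda>v. f x * differential A g x v + differential A f x v * g x"])
    (simp add: o_def param_chart chart_at_in_atlas in_chart_at)

lemma differential_compose: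
  assumes "smooth_fun_on A U f" "x \<in> U" "(\<phi> has_real_derivative D) (at (f x))"
  shows "differential A (\<lambda>y. \<phi> (f y)) x v = D * differential A f x v"
proof (rule differentialI)
  have "(\<phi> has_derivative (*) D) (at ((f \<circ> param (chart_at A x)) (snd (chart_at A x) x)))"
    using assms(3) by (simp add: has_field_derivative_def param_chart chart_at_in_atlas in_chart_at)
  from has_derivative_compose[OF differential_has_derivative[OF assms(1,2)] this]
  show "((\<lambda>y. \<phi> (f y)) \<circ> param (chart_at A x) has_derivative (\<lambda>v. D * differential A f x v))
      (at (snd (chart_at A x) x))"
    by (simp add: o_def)
qed

lemma smooth_fun_on_cong:
  assumes "open U" "smooth_fun_on A U f" "\<And>y. y \<in> U \<Longrightarrow> f y = g y"
  shows "smooth_fun_on A U g"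
  unfolding smooth_fun_on_def
proof
  fix c assume c: "c \<in> A"
  show "smooth_on (snd c ` (fst c \<inter> U)) (g \<circ> param c)"
    by (rule smooth_on_cong[OF open_chart_image[OF c assms(1)], of "f \<circ> param c"])
      (use assms c in \<open>auto simp: param_chart smooth_fun_on_def\<close>)
qed

lemma smooth_fun_on_subset: "smooth_fun_on A U f \<Longrightarrow> T \<subseteq> U \<Longrightarrow> smooth_fun_on A T f"
  by (fastforce simp: smooth_fun_on_def elim!: smooth_on_subset)

lemma smooth_fun_on_const: "smooth_fun_on A U (\<lambda>y. a)"
  by (simp add: smooth_fun_on_def o_def smooth_on_const)

lemma smooth_fun_on_compose:
  assumes "open U" "smooth_fun_on A U f" "smooth_on T \<phi>" "f ` U \<subseteq> T"
  shows "smooth_fun_on A U (\<lambda>y. \<phi> (f y))"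
  unfolding smooth_fun_on_def
proof
  fix c assume c: "c \<in> A"
  have "(f \<circ> param c) ` snd c ` (fst c \<inter> U) \<subseteq> T" using assms(4) c by (auto simp: param_chart)
  from smooth_on_compose[OF open_chart_image[OF c assms(1)] _ assms(3) this] assms(2) c
  show "smooth_on (snd c ` (fst c \<inter> U)) ((\<lambda>y. \<phi> (f y)) \<circ> param c)"
    by (simp add: smooth_fun_on_def o_def)
qed

text \<open>In any other chart the function is its representation in \<open>c\<close> composed with
  a smooth transition map.\<close>

lemma smooth_fun_onI_chart:
  assumes "c \<in> A" "open U" "U \<subseteq> fst c" "smooth_on (snd c ` U) (f \<circ> param c)"
  shows "smooth_fun_on A U f"
  unfolding smooth_fun_on_def
proof
  fix d assume d: "d \<in> A"
  have o: "open (snd d ` (fst d \<inter> U))" by (rule open_chart_image[OF d assms(2)])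
  have s: "smooth_on (snd d ` (fst d \<inter> U)) (snd c \<circ> param d)"
    by (rule smooth_on_subset[OF smooth_transition[OF d assms(1)]]) (use assms(3) in auto)
  have "(snd c \<circ> param d) ` snd d ` (fst d \<inter> U) \<subseteq> snd c ` U" using d by (auto simp: param_chart)
  from smooth_on_compose[OF o s assms(4) this]
  show "smooth_on (snd d ` (fst d \<inter> U)) (f \<circ> param d)"
    by (rule smooth_on_cong[OF o, rotated]) (use d assms(1,3) in \<open>auto simp: param_chart\<close>)
qed

lemma continuous_on_chart:
  assumes "c \<in> A" "U \<subseteq> fst c" "continuous_on (snd c ` U) (f \<circ> param c)"
  shows "continuous_on U f"
proof -
  have "continuous_on U (snd c)"
    using homeomorphism_chart[OF assms(1)] assms(2) homeomorphism_cont1 continuous_on_subset by blast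
  from continuous_on_compose[OF this assms(3)] show ?thesis
    by (rule continuous_on_eq) (use assms in \<open>auto simp: param_chart\<close>)
qed

lemma smooth_fun_on_imp_continuous_on:
  assumes "smooth_fun_on A U f" "open U"
  shows "continuous_on U f"
proof (subst continuous_on_eq_continuous_at[OF assms(2)], rule)
  fix x assume x: "x \<in> U"
  let ?c = "chart_at A x"
  have "continuous_on (U \<inter> fst ?c) f"
    using assms(1) smooth_on_imp_continuous_on chart_at_in_atlas
    by (intro continuous_on_chart[OF chart_at_in_atlas]) (auto simp: smooth_fun_on_def Int_commute o_def)
  then show "isCont f x"
    using continuous_on_eq_continuous_at[of "U \<inter> fst ?c" f] x assms(2) open_chart_domain[OF chart_at_in_atlas] in_chart_at
    by auto
qed

lemma smooth_field_on_cong: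
  assumes "open U" "smooth_field_on A U V" "\<And>y. y \<in> U \<Longrightarrow> V y = W y"
  shows "smooth_field_on A U W"
  unfolding smooth_field_on_def
proof
  fix c assume c: "c \<in> A"
  show "smooth_on (snd c ` (fst c \<inter> U)) ((\<lambda>y. chart_diff A c y (W y)) \<circ> param c)"
    by (rule smooth_on_cong[OF open_chart_image[OF c assms(1)], of "(\<lambda>y. chart_diff A c y (V y)) \<circ> param c"])
      (use assms c in \<open>auto simp: param_chart smooth_field_on_def\<close>)
qed

lemma smooth_field_on_subset: "smooth_field_on A U f \<Longrightarrow> T \<subseteq> U \<Longrightarrow> smooth_field_on A T f"
  by (fastforce simp: smooth_field_on_def elim!: smooth_on_subset)

lemma smooth_field_on_zero: "smooth_field_on A U (\<lambda>y. 0)"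
  unfolding smooth_field_on_def
proof
  fix c assume c: "c \<in> A"
  have "chart_diff A c y 0 = 0" if "y \<in> fst c" for y
    using linear_0[OF linear_chart_diff[OF c that]] .
  then have "smooth_on (snd c ` fst c) ((\<lambda>y. chart_diff A c y 0) \<circ> param c)"
    using c open_chart_image[OF c open_UNIV]
    by (intro smooth_on_cong[OF _ _ smooth_on_const[of _ 0]]) (auto simp: param_chart)
  then show "smooth_on (snd c ` (fst c \<inter> U)) ((\<lambda>y. chart_diff A c y 0) \<circ> param c)"
    by (rule smooth_on_subset) auto
qed

lemma smooth_field_on_add:
  assumes "open U" "smooth_field_on A U V" "smooth_field_on A U W"
  shows "smooth_field_on A U (\<lambda>y. V y + W y)"
  unfolding smooth_field_on_def
proof
  fix c assume c: "c \<in> A"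
  note o = open_chart_image[OF c assms(1)]
  have "smooth_on (snd c ` (fst c \<inter> U)) (\<lambda>q. ((\<lambda>y. chart_diff A c y (V y)) \<circ> param c) q +
     ((\<lambda>y. chart_diff A c y (W y)) \<circ> param c) q)"
    using assms(2,3) c by (intro smooth_on_add o) (auto simp: smooth_field_on_def o_def)
  then show "smooth_on (snd c ` (fst c \<inter> U)) ((\<lambda>y. chart_diff A c y (V y + W y)) \<circ> param c)"
    by (rule smooth_on_cong[OF o, rotated])
      (use c linear_add[OF linear_chart_diff[OF c]] in \<open>auto simp: param_chart\<close>)
qed

lemma smooth_field_on_scaleR:
  assumes "open U" "smooth_fun_on A U f" "smooth_field_on A U V"
  shows "smooth_field_on A U (\<lambda>y. f y *\<^sub>R V y)"
  unfolding smooth_field_on_def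
proof
  fix c assume c: "c \<in> A"
  note o = open_chart_image[OF c assms(1)]
  have "smooth_on (snd c ` (fst c \<inter> U)) (\<lambda>q. (f \<circ> param c) q *\<^sub>R ((\<lambda>y. chart_diff A c y (V y)) \<circ> param c) q)"
    using assms(2,3) c by (intro smooth_on_scaleR o) (auto simp: smooth_field_on_def smooth_fun_on_def o_def)
  then show "smooth_on (snd c ` (fst c \<inter> U)) ((\<lambda>y. chart_diff A c y (f y *\<^sub>R V y)) \<circ> param c)"
    by (rule smooth_on_cong[OF o, rotated])
      (use c linear_scale[OF linear_chart_diff[OF c]] in \<open>auto simp: param_chart\<close>)
qed

lemma smooth_field_on_sum:
  assumes "open U" "\<And>i. i \<in> I \<Longrightarrow> smooth_field_on A U (V i)"
  shows "smooth_field_on A U (\<lambda>y. \<Sum>i\<in>I. V i y)"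
  using assms(2)
  by (induction I rule: infinite_finite_induct)
    (simp_all add: smooth_field_on_zero smooth_field_on_add[OF assms(1)])

text \<open>In another chart \<open>d\<close> the components are the derivative of the transition
  map in the fixed direction \<open>u\<close>, read at the point transported from \<open>d\<close>
  to \<open>c\<close>.\<close>

lemma smooth_coord_field:
  assumes "c \<in> A"
  shows "smooth_field_on A (fst c) (coord_field A c u)"
  unfolding smooth_field_on_def
proof
  fix d assume d: "d \<in> A"
  have o: "open (snd d ` (fst d \<inter> fst c))" using open_chart_image[OF d open_chart_domain[OF assms]] .
  have s: "smooth_on (snd d ` (fst d \<inter> fst c)) (snd c \<circ> param d)" using smooth_transition[OF d assms] .
  have "(snd c \<circ> param d) ` snd d ` (fst d \<inter> fst c) \<subseteq> snd c ` (fst c \<inter> fst d)"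
    using d by (auto simp: param_chart)
  from smooth_on_compose[OF o s smooth_on_derivative[OF smooth_transition[OF assms d], of u] this]
  show "smooth_on (snd d ` (fst d \<inter> fst c)) ((\<lambda>x. chart_diff A d x (coord_field A c u x)) \<circ> param d)"
    by (rule smooth_on_cong[OF o, rotated])
      (use d assms in \<open>auto simp: param_chart chart_diff_coord_field jac_def\<close>)
qed

lemma smooth_fun_on_component:
  assumes "c \<in> A" "open U" "U \<subseteq> fst c" "smooth_field_on A U V"
  shows "smooth_fun_on A U (\<lambda>y. chart_diff A c y (V y) \<bullet> b)"
proof (rule smooth_fun_onI_chart[OF assms(1-3)])
  have "fst c \<inter> U = U" using assms(3) by auto
  with assms(1,4) have "smooth_on (snd c ` U) ((\<lambda>y. chart_diff A c y (V y)) \<circ> param c)"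
    by (metis smooth_field_on_def)
  with open_chart_image[OF assms(1,2)] \<open>fst c \<inter> U = U\<close>
  show "smooth_on (snd c ` U) ((\<lambda>y. chart_diff A c y (V y) \<bullet> b) \<circ> param c)"
    using smooth_on_inner by (fastforce simp: o_def)
qed

lemma smooth_fun_on_differential:
  assumes "open U" "smooth_fun_on A U f" "smooth_field_on A U V"
  shows "smooth_fun_on A U (\<lambda>y. differential A f y (V y))"
  unfolding smooth_fun_on_def
proof
  fix c assume c: "c \<in> A"
  note o = open_chart_image[OF c assms(1)]
  have "smooth_on (snd c ` (fst c \<inter> U)) (\<lambda>q. frechet_derivative (f \<circ> param c) (at q)
      (((\<lambda>y. chart_diff A c y (V y)) \<circ> param c) q))"
    using assms(2,3) c by (intro smooth_on_derivative_field o) (auto simp: smooth_field_on_def smooth_fun_on_def o_def)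
  then show "smooth_on (snd c ` (fst c \<inter> U)) ((\<lambda>y. differential A f y (V y)) \<circ> param c)"
    by (rule smooth_on_cong[OF o, rotated])
      (use c differential_chart[OF assms(2) c] in \<open>auto simp: param_chart\<close>)
qed

end

section \<open>The Hessian as a tensor\<close>

locale manifold_with_connection = smooth_manifold A
  for A :: "('x::{t2_space,second_countable_topology}, 'e::euclidean_space) chart set" +
  fixes nabla :: "('x \<Rightarrow> 'e) \<Rightarrow> ('x \<Rightarrow> 'e) \<Rightarrow> 'x \<Rightarrow> 'e"
  assumes connection: "affine_connection A nabla"
begin

lemma smooth_nabla:
  "open U \<Longrightarrow> smooth_field_on A U V \<Longrightarrow> smooth_field_on A U W \<Longrightarrow> smooth_field_on A U (nabla V W)"
  using connection unfolding affine_connection_def by blast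

lemma nabla_add_left:
  "open U \<Longrightarrow> smooth_field_on A U V \<Longrightarrow> smooth_field_on A U V' \<Longrightarrow> smooth_field_on A U W \<Longrightarrow> x \<in> U \<Longrightarrow>
    nabla (\<lambda>y. V y + V' y) W x = nabla V W x + nabla V' W x"
  using connection unfolding affine_connection_def by blast

lemma nabla_add_right:
  "open U \<Longrightarrow> smooth_field_on A U V \<Longrightarrow> smooth_field_on A U W \<Longrightarrow> smooth_field_on A U W' \<Longrightarrow> x \<in> U \<Longrightarrow>
    nabla V (\<lambda>y. W y + W' y) x = nabla V W x + nabla V W' x"
  using connection unfolding affine_connection_def by blast

lemma nabla_scaleR_left:
  "open U \<Longrightarrow> smooth_field_on A U V \<Longrightarrow> smooth_field_on A U W \<Longrightarrow> smooth_fun_on A U f \<Longrightarrow> x \<in> U \<Longrightarrow>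
    nabla (\<lambda>y. f y *\<^sub>R V y) W x = f x *\<^sub>R nabla V W x"
  using connection unfolding affine_connection_def by blast

lemma nabla_scaleR_right:
  "open U \<Longrightarrow> smooth_field_on A U V \<Longrightarrow> smooth_field_on A U W \<Longrightarrow> smooth_fun_on A U f \<Longrightarrow> x \<in> U \<Longrightarrow>
    nabla V (\<lambda>y. f y *\<^sub>R W y) x = differential A f x (V x) *\<^sub>R W x + f x *\<^sub>R nabla V W x"
  using connection unfolding affine_connection_def by blast

text \<open>Locality: a field vanishing on \<open>U\<close> equals its product with the indicator function of the
  complement of \<open>U\<close>, which is smooth on \<open>U\<close>.\<close>

lemma nabla_vanishing:
  assumes "open U" "x \<in> U" "\<And>y. y \<in> U \<Longrightarrow> Z y = 0" "smooth_field_on A U W"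
  shows "nabla Z W x = 0" "nabla W Z x = 0"
proof -
  let ?f = "\<lambda>y. if y \<in> U then 0 else 1 :: real"
  have f: "smooth_fun_on A U ?f"
    by (rule smooth_fun_on_cong[OF assms(1) smooth_fun_on_const[of _ 0]]) auto
  have Z: "smooth_field_on A U Z"
    by (rule smooth_field_on_cong[OF assms(1) smooth_field_on_zero]) (use assms(3) in auto)
  have eq: "(\<lambda>y. ?f y *\<^sub>R Z y) = Z" using assms(3) by (auto simp: fun_eq_iff)
  show "nabla Z W x = 0"
    using nabla_scaleR_left[OF assms(1) Z assms(4) f assms(2)] assms(2) by (simp only: eq) simp
  show "nabla W Z x = 0"
    using nabla_scaleR_right[OF assms(1) assms(4) Z f assms(2)] assms(2,3) by (simp only: eq) simp
qed

text \<open>\<open>V'\<close> is the sum of \<open>V\<close> and a field that vanishes on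
  \<open>U\<close>, so additivity reduces the claim to the vanishing case.\<close>

lemma nabla_cong_left:
  assumes "open U" "x \<in> U" "\<And>y. y \<in> U \<Longrightarrow> V y = V' y"
    and "smooth_field_on A U V" "smooth_field_on A U W"
  shows "nabla V W x = nabla V' W x"
proof -
  have "smooth_field_on A U (\<lambda>y. V' y - V y)"
    by (rule smooth_field_on_cong[OF assms(1) smooth_field_on_zero]) (use assms(3) in auto)
  from nabla_add_left[OF assms(1,4) this assms(5,2)]
  show ?thesis using nabla_vanishing(1)[OF assms(1,2) _ assms(5), of "\<lambda>y. V' y - V y"] assms(3) by simp
qed

lemma nabla_cong_right:
  assumes "open U" "x \<in> U" "\<And>y. y \<in> U \<Longrightarrow> W y = W' y"
    and "smooth_field_on A U V" "smooth_field_on A U W"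
  shows "nabla V W x = nabla V W' x"
proof -
  have "smooth_field_on A U (\<lambda>y. W' y - W y)"
    by (rule smooth_field_on_cong[OF assms(1) smooth_field_on_zero]) (use assms(3) in auto)
  from nabla_add_right[OF assms(1,4,5) this assms(2)]
  show ?thesis using nabla_vanishing(2)[OF assms(1,2) _ assms(4), of "\<lambda>y. W' y - W y"] assms(3) by simp
qed

text \<open>\<open>hessian\<close> extends its arguments through a chart that changes with the
  point. Keeping two fields fixed instead gives a function of \<open>x\<close> whose continuity can
  be discussed, and linearity over functions in both fields then expresses that the Hessian is a
  tensor.\<close>

definition field_hessian :: "('x \<Rightarrow> real) \<Rightarrow> ('x \<Rightarrow> 'e) \<Rightarrow> ('x \<Rightarrow> 'e) \<Rightarrow> 'x \<Rightarrow> real" where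
  "field_hessian f V W x =
     differential A (\<lambda>y. differential A f y (W y)) x (V x) - differential A f x (nabla V W x)"

lemma hessian_field_hessian:
  "hessian A nabla f x v w =
     field_hessian f (coord_field A (chart_at A x) v) (coord_field A (chart_at A x) w) x"
  by (simp add: hessian_def field_hessian_def Let_def)

context
  fixes U :: "'x set" and f :: "'x \<Rightarrow> real"
  assumes U: "open U" and f: "smooth_fun_on A U f"
begin

lemma continuous_on_field_hessian:
  assumes "smooth_field_on A U V" "smooth_field_on A U W"
  shows "continuous_on U (field_hessian f V W)"
  unfolding field_hessian_def
  by (intro continuous_on_diff smooth_fun_on_imp_continuous_on[OF _ U] smooth_fun_on_differential[OF U]
      f assms smooth_nabla[OF U])

lemma field_hessian_cong_left:
  assumes "x \<in> U" "\<And>y. y \<in> U \<Longrightarrow> V y = V' y" "smooth_field_on A U V" "smooth_field_on A U W"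
  shows "field_hessian f V W x = field_hessian f V' W x"
  using nabla_cong_left[OF U assms] assms(1,2) by (simp add: field_hessian_def)

lemma field_hessian_cong_right:
  assumes "x \<in> U" "\<And>y. y \<in> U \<Longrightarrow> W y = W' y" "smooth_field_on A U V" "smooth_field_on A U W"
  shows "field_hessian f V W x = field_hessian f V W' x"
  using nabla_cong_right[OF U assms]
    differential_cong[OF U assms(1), of "\<lambda>y. differential A f y (W y)" "\<lambda>y. differential A f y (W' y)"] assms(2)
  by (simp add: field_hessian_def)

lemma field_hessian_add_left:
  assumes "x \<in> U" "smooth_field_on A U V" "smooth_field_on A U V'" "smooth_field_on A U W"
  shows "field_hessian f (\<lambda>y. V y + V' y) W x = field_hessian f V W x + field_hessian f V' W x"
  using nabla_add_left[OF U assms(2-4,1)] linear_add[OF linear_differential[OF f assms(1)]]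
    linear_add[OF linear_differential[OF smooth_fun_on_differential[OF U f assms(4)] assms(1)]]
  by (simp add: field_hessian_def)

lemma field_hessian_scaleR_left:
  assumes "x \<in> U" "smooth_field_on A U V" "smooth_fun_on A U a" "smooth_field_on A U W"
  shows "field_hessian f (\<lambda>y. a y *\<^sub>R V y) W x = a x * field_hessian f V W x"
  using nabla_scaleR_left[OF U assms(2,4,3,1)] linear_scale[OF linear_differential[OF f assms(1)]]
    linear_scale[OF linear_differential[OF smooth_fun_on_differential[OF U f assms(4)] assms(1)]]
  by (simp add: field_hessian_def algebra_simps)

lemma field_hessian_add_right:
  assumes "x \<in> U" "smooth_field_on A U V" "smooth_field_on A U W" "smooth_field_on A U W'"
  shows "field_hessian f V (\<lambda>y. W y + W' y) x = field_hessian f V W x + field_hessian f V W' x"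
proof -
  have "differential A (\<lambda>y. differential A f y (W y + W' y)) x (V x) =
      differential A (\<lambda>y. differential A f y (W y) + differential A f y (W' y)) x (V x)"
    by (rule differential_cong[OF U assms(1)]) (rule linear_add[OF linear_differential[OF f]])
  also have "\<dots> = differential A (\<lambda>y. differential A f y (W y)) x (V x) +
      differential A (\<lambda>y. differential A f y (W' y)) x (V x)"
    by (rule differential_add[OF smooth_fun_on_differential[OF U f assms(3)]
          smooth_fun_on_differential[OF U f assms(4)] assms(1)])
  finally show ?thesis
    using nabla_add_right[OF U assms(2-4,1)] linear_add[OF linear_differential[OF f assms(1)]]
    by (simp add: field_hessian_def)
qed

text \<open>The derivative of \<open>a\<close> along \<open>V\<close> enters both the iterated
  derivative and the connection term and cancels; this is the purpose of the correction by the
  connection.\<close>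

lemma field_hessian_scaleR_right:
  assumes "x \<in> U" "smooth_field_on A U V" "smooth_fun_on A U a" "smooth_field_on A U W"
  shows "field_hessian f V (\<lambda>y. a y *\<^sub>R W y) x = a x * field_hessian f V W x"
proof -
  have "differential A (\<lambda>y. differential A f y (a y *\<^sub>R W y)) x (V x) =
      differential A (\<lambda>y. a y * differential A f y (W y)) x (V x)"
    by (rule differential_cong[OF U assms(1)])
      (use linear_scale[OF linear_differential[OF f]] in simp)
  also have "\<dots> = a x * differential A (\<lambda>y. differential A f y (W y)) x (V x) +
      differential A a x (V x) * differential A f x (W x)"
    by (rule differential_mult[OF assms(3) smooth_fun_on_differential[OF U f assms(4)] assms(1)])
  finally show ?thesis
    using nabla_scaleR_right[OF U assms(2,4,3,1)] linear_add[OF linear_differential[OF f assms(1)]]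
      linear_scale[OF linear_differential[OF f assms(1)]]
    by (simp add: field_hessian_def algebra_simps)
qed

lemma field_hessian_sum_left:
  assumes "x \<in> U" "smooth_field_on A U W" "finite I" "\<And>i. i \<in> I \<Longrightarrow> smooth_field_on A U (V i)"
  shows "field_hessian f (\<lambda>y. \<Sum>i\<in>I. V i y) W x = (\<Sum>i\<in>I. field_hessian f (V i) W x)"
  using assms(3,4)
proof (induction I rule: finite_induct)
  case empty
  show ?case
    using field_hessian_scaleR_left[OF assms(1) smooth_field_on_zero smooth_fun_on_const[of _ 0] assms(2)] by simp
next
  case (insert i I)
  then show ?case
    using field_hessian_add_left[OF assms(1) _ smooth_field_on_sum[OF U] assms(2), of "V i" I V] by simp
qed

lemma field_hessian_sum_right:
  assumes "x \<in> U" "smooth_field_on A U V" "finite I" "\<And>i. i \<in> I \<Longrightarrow> smooth_field_on A U (W i)"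
  shows "field_hessian f V (\<lambda>y. \<Sum>i\<in>I. W i y) x = (\<Sum>i\<in>I. field_hessian f V (W i) x)"
  using assms(3,4)
proof (induction I rule: finite_induct)
  case empty
  show ?case
    using field_hessian_scaleR_right[OF assms(1,2) smooth_fun_on_const[of _ 0] smooth_field_on_zero] by simp
next
  case (insert i I)
  then show ?case
    using field_hessian_add_right[OF assms(1,2) _ smooth_field_on_sum[OF U], of "W i" I W] by simp
qed

lemma field_hessian_expansion_chart:
  assumes "c \<in> A" "U \<subseteq> fst c" "x \<in> U" "smooth_field_on A U V" "smooth_field_on A U W"
  shows "field_hessian f V W x = (\<Sum>b\<in>Basis. \<Sum>b'\<in>Basis.
    (chart_diff A c x (V x) \<bullet> b) * (chart_diff A c x (W x) \<bullet> b') *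
      field_hessian f (coord_field A c b) (coord_field A c b') x)"
proof -
  have E: "smooth_field_on A U (coord_field A c b)" for b
    using smooth_field_on_subset[OF smooth_coord_field[OF assms(1)] assms(2)] .
  have comp: "smooth_fun_on A U (\<lambda>y. chart_diff A c y (V y) \<bullet> b)" if "smooth_field_on A U V" for V b
    using smooth_fun_on_component[OF assms(1) U assms(2) that] .
  \<comment> \<open>The expansion is needed on all of \<open>U\<close> and not only at
    \<open>x\<close>: the second field gets differentiated, so the congruence rules ask for equality
    on an open set.\<close>
  have exp: "V y = (\<Sum>b\<in>Basis. (chart_diff A c y (V y) \<bullet> b) *\<^sub>R coord_field A c b y)" if "y \<in> U" for V y
    using vector_expansion[OF assms(1), of y "V y"] that assms(2) by auto
  have summand: "smooth_field_on A U (\<lambda>y. (chart_diff A c y (V y) \<bullet> b) *\<^sub>R coord_field A c b y)"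
    if "smooth_field_on A U V" for V b
    using smooth_field_on_scaleR[OF U comp[OF that] E] .
  have "field_hessian f V W x = (\<Sum>b\<in>Basis. (chart_diff A c x (V x) \<bullet> b) * field_hessian f (coord_field A c b) W x)"
    using field_hessian_cong_left[OF assms(3) exp[of _ V] assms(4,5)]
      field_hessian_sum_left[OF assms(3,5) finite_Basis summand[OF assms(4)]]
      field_hessian_scaleR_left[OF assms(3) E comp[OF assms(4)] assms(5)]
    by simp
  moreover have "field_hessian f V' W x = (\<Sum>b\<in>Basis. (chart_diff A c x (W x) \<bullet> b) * field_hessian f V' (coord_field A c b) x)"
    if "smooth_field_on A U V'" for V'
    using field_hessian_cong_right[OF assms(3) exp[of _ W] that assms(5)]
      field_hessian_sum_right[OF assms(3) that finite_Basis summand[OF assms(5)]]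
      field_hessian_scaleR_right[OF assms(3) that comp[OF assms(5)] E]
    by simp
  ultimately show ?thesis using E by (simp add: sum_distrib_left mult.assoc)
qed

end

text \<open>The chart \<open>c\<close> need not be the preferred one at \<open>x\<close>. This frees
  the Hessian from the preferred charts, so that its values at different points of one chart can be
  compared.\<close>

lemma hessian_expansion:
  assumes "open U" "smooth_fun_on A U f" "c \<in> A" "x \<in> fst c" "x \<in> U"
  shows "hessian A nabla f x v w = (\<Sum>b\<in>Basis. \<Sum>b'\<in>Basis.
    (chart_diff A c x v \<bullet> b) * (chart_diff A c x w \<bullet> b') *
      field_hessian f (coord_field A c b) (coord_field A c b') x)"
proof -
  let ?U = "U \<inter> fst c \<inter> fst (chart_at A x)"
  have U: "open ?U" using assms open_chart_domain chart_at_in_atlas by (intro open_Int) auto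
  have f: "smooth_fun_on A ?U f" by (rule smooth_fun_on_subset[OF assms(2)]) auto
  have "smooth_field_on A ?U (coord_field A (chart_at A x) u)" for u
    by (rule smooth_field_on_subset[OF smooth_coord_field[OF chart_at_in_atlas]]) auto
  from field_hessian_expansion_chart[OF U f assms(3) _ _ this this, of x v w] assms in_chart_at
  show ?thesis by (auto simp add: hessian_field_hessian coord_field_chart_at)
qed

lemma continuous_on_hessian_coefficient:
  assumes "open U" "smooth_fun_on A U f" "c \<in> A"
  shows "continuous_on (U \<inter> fst c) (field_hessian f (coord_field A c u) (coord_field A c v))"
proof (rule continuous_on_field_hessian)
  show "open (U \<inter> fst c)" using assms by (simp add: open_Int open_chart_domain)
  show "smooth_fun_on A (U \<inter> fst c) f" by (rule smooth_fun_on_subset[OF assms(2)]) auto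
  show "smooth_field_on A (U \<inter> fst c) (coord_field A c u)" "smooth_field_on A (U \<inter> fst c) (coord_field A c v)"
    by (rule smooth_field_on_subset[OF smooth_coord_field[OF assms(3)]]; simp)+
qed

text \<open>Along \<open>W\<close> the derivative of the composite is \<open>\<phi>' (f y)\<close>
  times that of \<open>f\<close>; the product of differentials appears when this product is
  differentiated along \<open>V\<close>. Smoothness of \<open>\<phi>'\<close> on \<open>T\<close>
  makes the first factor smooth, as the product rule requires.\<close>

lemma hessian_compose:
  assumes "open U" "smooth_fun_on A U f" "x \<in> U"
    and "\<And>y. y \<in> U \<Longrightarrow> (\<phi> has_real_derivative \<phi>' (f y)) (at (f y))"
    and "(\<phi>' has_real_derivative \<phi>'') (at (f x))" "smooth_on T \<phi>'" "f ` U \<subseteq> T"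
  shows "hessian A nabla (\<lambda>y. \<phi> (f y)) x v w =
    \<phi>' (f x) * hessian A nabla f x v w + \<phi>'' * (differential A f x v * differential A f x w)"
proof -
  let ?c = "chart_at A x"
  let ?V = "coord_field A ?c v" and ?W = "coord_field A ?c w" and ?U = "U \<inter> fst ?c"
  have U: "open ?U" using assms open_chart_domain chart_at_in_atlas by (intro open_Int) auto
  have x: "x \<in> ?U" using assms in_chart_at by auto
  have f: "smooth_fun_on A ?U f" by (rule smooth_fun_on_subset[OF assms(2)]) auto
  have W: "smooth_field_on A ?U ?W"
    by (rule smooth_field_on_subset[OF smooth_coord_field[OF chart_at_in_atlas]]) auto
  have Wf: "smooth_fun_on A ?U (\<lambda>y. differential A f y (?W y))"
    using smooth_fun_on_differential[OF U f W] .
  have \<phi>'f: "smooth_fun_on A ?U (\<lambda>y. \<phi>' (f y))"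
    using assms(7) by (intro smooth_fun_on_compose[OF U f assms(6)]) auto
  have "differential A (\<lambda>y. differential A (\<lambda>y. \<phi> (f y)) y (?W y)) x v =
      differential A (\<lambda>y. \<phi>' (f y) * differential A f y (?W y)) x v"
    by (rule differential_cong[OF U x]) (use differential_compose[OF f _ assms(4)] in auto)
  also have "\<dots> = \<phi>' (f x) * differential A (\<lambda>y. differential A f y (?W y)) x v +
      \<phi>'' * differential A f x v * differential A f x w"
    using differential_mult[OF \<phi>'f Wf x] differential_compose[OF f x assms(5)]
    by (simp add: coord_field_chart_at)
  finally show ?thesis
    using differential_compose[OF f x assms(4)] assms(3)
    by (simp add: hessian_def Let_def coord_field_chart_at algebra_simps)
qed

end

section \<open>Traces\<close>

definition orthonormal_wrt :: "('e::euclidean_space \<Rightarrow> 'e \<Rightarrow> real) \<Rightarrow> 'e set \<Rightarrow> bool" where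
  "orthonormal_wrt g E \<longleftrightarrow> finite E \<and> (\<forall>a\<in>E. \<forall>b\<in>E. g a b = (if a = b then 1 else 0))"

lemma bilinear_expansion:
  assumes "bilinear B"
  shows "B (\<Sum>i\<in>I. x i *\<^sub>R e i) (\<Sum>j\<in>J. y j *\<^sub>R f j) = (\<Sum>i\<in>I. \<Sum>j\<in>J. x i * y j * B (e i) (f j))"
proof -
  have left: "B (\<Sum>i\<in>I. x i *\<^sub>R e i) z = (\<Sum>i\<in>I. x i * B (e i) z)" for z
  proof -
    have lin: "linear (\<lambda>x. B x z)" using assms by (simp add: bilinear_def)
    show ?thesis by (simp add: linear_sum[OF lin] linear_scale[OF lin])
  qed
  have right: "B z (\<Sum>j\<in>J. y j *\<^sub>R f j) = (\<Sum>j\<in>J. y j * B z (f j))" for z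
  proof -
    have lin: "linear (B z)" using assms by (simp add: bilinear_def)
    show ?thesis by (simp add: linear_sum[OF lin] linear_scale[OF lin])
  qed
  have "B (\<Sum>i\<in>I. x i *\<^sub>R e i) (\<Sum>j\<in>J. y j *\<^sub>R f j) = (\<Sum>i\<in>I. x i * B (e i) (\<Sum>j\<in>J. y j *\<^sub>R f j))"
    by (rule left)
  then show ?thesis unfolding right sum_distrib_left mult.assoc .
qed

text \<open>The metric at a point is in general not the ambient inner product of \<open>'e\<close>,
  so orthonormality, Gram-Schmidt and traces are developed for an arbitrary positive definite
  form.\<close>

locale inner_form =
  fixes g :: "'e::euclidean_space \<Rightarrow> 'e \<Rightarrow> real"
  assumes bilinear: "bilinear g" and sym: "g v w = g w v" and pos: "v \<noteq> 0 \<Longrightarrow> g v v > 0"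
begin

lemma linear_left: "linear (\<lambda>v. g v w)" and linear_right: "linear (g v)"
  using bilinear by (auto simp: bilinear_def)

lemma orthonormal_expansion:
  assumes "orthonormal_wrt g E" "x \<in> span E"
  shows "x = (\<Sum>e\<in>E. g x e *\<^sub>R e)"
  using assms(2)
proof (induction rule: span_induct)
  case base
  have scale: "c *\<^sub>R x = (\<Sum>e\<in>E. g (c *\<^sub>R x) e *\<^sub>R e)" if "x = (\<Sum>e\<in>E. g x e *\<^sub>R e)" for c x
  proof -
    have "c *\<^sub>R x = c *\<^sub>R (\<Sum>e\<in>E. g x e *\<^sub>R e)" by (rule arg_cong[OF that])
    also have "\<dots> = (\<Sum>e\<in>E. g (c *\<^sub>R x) e *\<^sub>R e)"
      by (simp add: scaleR_sum_right linear_scale[OF linear_left])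
    finally show ?thesis .
  qed
  have add: "x + y = (\<Sum>e\<in>E. g (x + y) e *\<^sub>R e)"
    if "x = (\<Sum>e\<in>E. g x e *\<^sub>R e)" "y = (\<Sum>e\<in>E. g y e *\<^sub>R e)" for x y
  proof -
    have "x + y = (\<Sum>e\<in>E. g x e *\<^sub>R e) + (\<Sum>e\<in>E. g y e *\<^sub>R e)" by (rule arg_cong2[OF that])
    also have "\<dots> = (\<Sum>e\<in>E. g (x + y) e *\<^sub>R e)"
      by (simp add: linear_add[OF linear_left] scaleR_left_distrib sum.distrib)
    finally show ?thesis .
  qed
  show ?case unfolding subspace_def mem_Collect_eq
    by (intro conjI ballI allI scale add) (simp_all add: linear_0[OF linear_left])
next
  case (step x)
  then have "(\<Sum>e\<in>E. g x e *\<^sub>R e) = (\<Sum>e\<in>E. if x = e then e else 0)"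
    using assms(1) by (intro sum.cong) (auto simp: orthonormal_wrt_def)
  with step assms(1) show ?case by (simp add: orthonormal_wrt_def)
qed

lemma gram_schmidt: "finite B \<Longrightarrow> \<exists>E. orthonormal_wrt g E \<and> span E = span B"
proof (induction B rule: finite_induct)
  case empty
  then show ?case by (intro exI[of _ "{}"]) (simp add: orthonormal_wrt_def)
next
  case (insert a B)
  then obtain E where E: "orthonormal_wrt g E" "span E = span B" by blast
  \<comment> \<open>The \<open>g\<close>-orthogonal projection of \<open>a\<close> to
    \<open>span B\<close>. Either it equals \<open>a\<close> and no vector is added, or the
    normalized difference is the new basis vector.\<close>
  define p where "p = (\<Sum>e\<in>E. g a e *\<^sub>R e)"
  have p: "p \<in> span B" unfolding p_def E(2)[symmetric] by (intro span_sum span_scale span_base)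
  show ?case
  proof (cases "a = p")
    case True
    then show ?thesis using E p by (metis span_redundant)
  next
    case False
    have orth: "g (a - p) e = 0" if "e \<in> E" for e
    proof -
      have "g p e = (\<Sum>d\<in>E. g a d * g d e)"
        unfolding p_def by (simp add: linear_sum[OF linear_left] linear_scale[OF linear_left])
      also have "\<dots> = (\<Sum>d\<in>E. if d = e then g a e else 0)"
        using E(1) that by (intro sum.cong) (auto simp: orthonormal_wrt_def)
      finally show ?thesis using E(1) that
        by (simp add: orthonormal_wrt_def linear_diff[OF linear_left])
    qed
    define s where "s = sqrt (g (a - p) (a - p))"
    have s: "s > 0" "s * s = g (a - p) (a - p)" using pos[of "a - p"] False by (auto simp: s_def)
    define n where "n = (1 / s) *\<^sub>R (a - p)"
    have nn: "g n n = 1"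
      using s unfolding n_def linear_scale[OF linear_left] linear_scale[OF linear_right]
      by (simp flip: s(2))
    have ne: "g n e = 0" "g e n = 0" if "e \<in> E" for e
      using orth[OF that] sym by (simp_all add: n_def linear_scale[OF linear_left] linear_scale[OF linear_right])
    have "orthonormal_wrt g (insert n E)"
      using E(1) nn ne by (auto simp: orthonormal_wrt_def)
    moreover have "span (insert a B) = span (insert n E)"
    proof (rule span_unique)
      show "insert a B \<subseteq> span (insert n E)"
      proof -
        have "a = p + s *\<^sub>R n" using s(1) by (simp add: n_def)
        moreover have "span B \<subseteq> span (insert n E)" unfolding E(2)[symmetric] by (intro span_mono) auto
        ultimately show ?thesis
          using p by (auto intro: span_add span_scale span_base)
      qed
      show "span (insert n E) \<subseteq> T" if "insert a B \<subseteq> T" "subspace T" for T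
      proof (rule span_minimal[OF _ that(2)])
        have "span E \<subseteq> T" unfolding E(2) using that by (intro span_minimal) auto
        then show "insert n E \<subseteq> T"
          using that p E(2) span_superset[of E] unfolding n_def
          by (auto intro!: subspace_scale subspace_diff)
      qed
    qed simp
    ultimately show ?thesis by metis
  qed
qed

lemma orthonormal_independent:
  assumes "orthonormal_wrt g E"
  shows "independent E"
  unfolding independent_explicit_finite_subsets
proof safe
    fix T u v assume T: "T \<subseteq> E" "finite T" "(\<Sum>v\<in>T. u v *\<^sub>R v) = 0" "v \<in> T"
    have "0 = g (\<Sum>v\<in>T. u v *\<^sub>R v) v" using T(3) by (simp add: linear_0[OF linear_left])
    also have "\<dots> = (\<Sum>w\<in>T. u w * g w v)"
      by (simp add: linear_sum[OF linear_left] linear_scale[OF linear_left])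
    also have "\<dots> = (\<Sum>w\<in>T. if w = v then u v else 0)"
      using assms T by (intro sum.cong) (auto simp: orthonormal_wrt_def subset_iff)
    finally show "u v = 0" using T by simp
qed

text \<open>\<open>trace_on\<close> sums over a chosen basis, and Gram-Schmidt provides one to
  choose. The basis depends on \<open>g\<close> and \<open>W\<close> alone and serves every
  \<open>B\<close>, so traces of different forms can be compared summand by summand.\<close>

lemma trace_on_basis:
  assumes "subspace W"
  obtains E where "orthonormal_wrt g E" "span E = W" "\<And>B. trace_on g W B = (\<Sum>e\<in>E. B e e)"
proof -
  obtain B where "finite B" "span B = W"
    using basis_exists[of W] assms by (metis finiteI_independent span_subspace)
  then obtain E0 where "orthonormal_wrt g E0" "span E0 = W" using gram_schmidt by metis
  define P where
    "P E \<longleftrightarrow> finite E \<and> span E = W \<and> (\<forall>a\<in>E. \<forall>b\<in>E. g a b = (if a = b then 1 else 0))" for E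
  have "P E0" using \<open>orthonormal_wrt g E0\<close> \<open>span E0 = W\<close> by (simp add: P_def orthonormal_wrt_def)
  then have E: "P (SOME E. P E)" by (rule someI)
  show ?thesis
  proof (rule that)
    show "orthonormal_wrt g (SOME E. P E)" "span (SOME E. P E) = W"
      using E unfolding P_def orthonormal_wrt_def by blast+
    show "trace_on g W B = (\<Sum>e\<in>(SOME E. P E). B e e)" for B
      unfolding trace_on_def P_def ..
  qed
qed

text \<open>Expanding each \<open>e\<close> in \<open>F\<close> and exchanging sums leaves the
  coefficients \<open>\<Sum>e\<in>E. g e f * g e f'\<close>, which equal \<open>g f f'\<close> by
  Parseval for \<open>E\<close>. The trace may thus be computed in any orthonormal basis, in
  particular in a limit of frames.\<close>

lemma trace_on_orthonormal:
  assumes "orthonormal_wrt g F" "bilinear B"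
  shows "trace_on g (span F) B = (\<Sum>f\<in>F. B f f)"
proof -
  obtain E where E: "orthonormal_wrt g E" "span E = span F" "trace_on g (span F) B = (\<Sum>e\<in>E. B e e)"
    using trace_on_basis[OF subspace_span] by metis
  have "(\<Sum>e\<in>E. B e e) = (\<Sum>e\<in>E. \<Sum>f\<in>F. \<Sum>f'\<in>F. g e f * g e f' * B f f')"
  proof (rule sum.cong[OF refl])
    fix e assume "e \<in> E"
    then have "e = (\<Sum>f\<in>F. g e f *\<^sub>R f)"
      using orthonormal_expansion[OF assms(1), of e] E(2) span_base by metis
    then have "B e e = B (\<Sum>f\<in>F. g e f *\<^sub>R f) (\<Sum>f\<in>F. g e f *\<^sub>R f)"
      by (rule arg_cong[where f = "\<lambda>z. B z z"])
    then show "B e e = (\<Sum>f\<in>F. \<Sum>f'\<in>F. g e f * g e f' * B f f')"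
      unfolding bilinear_expansion[OF assms(2)] .
  qed
  also have "\<dots> = (\<Sum>f\<in>F. \<Sum>e\<in>E. \<Sum>f'\<in>F. g e f * g e f' * B f f')"
    by (rule sum.swap)
  also have "\<dots> = (\<Sum>f\<in>F. \<Sum>f'\<in>F. \<Sum>e\<in>E. g e f * g e f' * B f f')"
    by (intro sum.cong refl sum.swap)
  also have "\<dots> = (\<Sum>f\<in>F. \<Sum>f'\<in>F. (\<Sum>e\<in>E. g e f * g e f') * B f f')"
    by (simp add: sum_distrib_right)
  also have "\<dots> = (\<Sum>f\<in>F. \<Sum>f'\<in>F. g f f' * B f f')"
  proof (intro sum.cong refl)
    fix f f' assume "f \<in> F"
    then have "f = (\<Sum>e\<in>E. g f e *\<^sub>R e)"
      using orthonormal_expansion[OF E(1), of f] E(2) span_base by metis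
    then have "g f f' = g (\<Sum>e\<in>E. g f e *\<^sub>R e) f'"
      by (rule arg_cong[where f = "\<lambda>z. g z f'"])
    also have "\<dots> = (\<Sum>e\<in>E. g e f * g e f')"
      by (simp add: linear_sum[OF linear_left] linear_scale[OF linear_left] sym[of f])
    finally show "(\<Sum>e\<in>E. g e f * g e f') * B f f' = g f f' * B f f'" by simp
  qed
  also have "\<dots> = (\<Sum>f\<in>F. \<Sum>f'\<in>F. if f = f' then B f f' else 0)"
    using assms(1) by (intro sum.cong refl) (auto simp: orthonormal_wrt_def)
  also have "\<dots> = (\<Sum>f\<in>F. B f f)" using assms(1) by (simp add: orthonormal_wrt_def)
  finally show ?thesis using E(3) by simp
qed

section \<open>Indexed orthonormal frames and convergent subsequences\<close>

text \<open>The indexing by numbers is what allows a sequence of frames to converge entry by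
  entry.\<close>

definition orthonormal_frame :: "nat \<Rightarrow> (nat \<Rightarrow> 'e) \<Rightarrow> bool" where
  "orthonormal_frame m e \<longleftrightarrow> (\<forall>i<m. \<forall>j<m. g (e i) (e j) = (if i = j then 1 else 0))"

lemma orthonormal_frame_inj: "orthonormal_frame m e \<Longrightarrow> inj_on e {..<m}"
proof (rule inj_onI, rule ccontr)
  fix i j assume a: "orthonormal_frame m e" "i \<in> {..<m}" "j \<in> {..<m}" "e i = e j" "i \<noteq> j"
  have "g (e i) (e j) = 0" "g (e i) (e i) = 1"
    using a(1,2,3,5) unfolding orthonormal_frame_def by simp_all
  with a(4) show False by simp
qed

lemma orthonormal_frame_set: "orthonormal_frame m e \<Longrightarrow> orthonormal_wrt g (e ` {..<m})"
  unfolding orthonormal_wrt_def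
proof (intro conjI ballI)
  fix a b assume e: "orthonormal_frame m e" and "a \<in> e ` {..<m}" "b \<in> e ` {..<m}"
  then obtain i j where "i < m" "j < m" "a = e i" "b = e j" by auto
  then show "g a b = (if a = b then 1 else 0)"
    using e inj_on_eq_iff[OF orthonormal_frame_inj[OF e], of i j] by (simp add: orthonormal_frame_def)
qed simp

lemma dim_span_frame:
  assumes "orthonormal_frame m e"
  shows "dim (span (e ` {..<m})) = m"
  using dim_eq_card_independent[OF orthonormal_independent[OF orthonormal_frame_set[OF assms]]]
    card_image[OF orthonormal_frame_inj[OF assms]] by simp

lemma trace_on_span_frame:
  assumes "orthonormal_frame m e" "bilinear B"
  shows "trace_on g (span (e ` {..<m})) B = (\<Sum>i<m. B (e i) (e i))"
  using trace_on_orthonormal[OF orthonormal_frame_set[OF assms(1)] assms(2)]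
    sum.reindex[OF orthonormal_frame_inj[OF assms(1)]] by simp

lemma trace_on_frame:
  assumes "subspace W" "dim W = m"
  obtains e where "orthonormal_frame m e" "\<And>i. i < m \<Longrightarrow> e i \<in> W"
    "\<And>B. trace_on g W B = (\<Sum>i<m. B (e i) (e i))"
proof -
  obtain E where E: "orthonormal_wrt g E" "span E = W" "\<And>B. trace_on g W B = (\<Sum>e\<in>E. B e e)"
    using trace_on_basis[OF assms(1)] by metis
  have "card E = m"
    using dim_eq_card_independent[OF orthonormal_independent[OF E(1)]] E(2) assms(2) by (metis dim_span)
  moreover have "finite E" using E(1) by (simp add: orthonormal_wrt_def)
  ultimately obtain e where e: "bij_betw e {..<m} E"
    using ex_bij_betw_nat_finite[of E] by (auto simp: atLeast0LessThan)
  have mem: "e i \<in> E" if "i < m" for i using e that by (auto simp: bij_betw_def)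
  show ?thesis
  proof (rule that[of e])
    show "orthonormal_frame m e"
      unfolding orthonormal_frame_def
    proof (intro allI impI)
      fix i j assume "i < m" "j < m"
      then show "g (e i) (e j) = (if i = j then 1 else 0)"
        using E(1) mem inj_on_eq_iff[OF bij_betw_imp_inj_on[OF e], of i j] by (simp add: orthonormal_wrt_def)
    qed
    show "e i \<in> W" if "i < m" for i using mem[OF that] E(2) span_base by blast
    show "trace_on g W B = (\<Sum>i<m. B (e i) (e i))" for B
      using E(3)[of B] sum.reindex_bij_betw[OF e, of "\<lambda>a. B a a"] by simp
  qed
qed

end

text \<open>Bolzano-Weierstrass is applied to one entry at a time; limits already obtained survive
  the passage to a further subsequence.\<close>

lemma bounded_tuple_convergent_subsequence:
  fixes X :: "nat \<Rightarrow> nat \<Rightarrow> 'a::euclidean_space"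
  assumes "\<And>i. i < m \<Longrightarrow> bounded (range (\<lambda>k. X k i))"
  shows "\<exists>r l. strict_mono r \<and> (\<forall>i<m. (\<lambda>k. X (r k) i) \<longlonglongrightarrow> l i)"
  using assms
proof (induction m)
  case 0
  then show ?case by (auto intro: exI[of _ id] simp: strict_mono_id)
next
  case (Suc m)
  then obtain r l where r: "strict_mono r" "\<forall>i<m. (\<lambda>k. X (r k) i) \<longlonglongrightarrow> l i" by fastforce
  have "bounded (range (\<lambda>k. X (r k) m))"
    by (rule bounded_subset[OF Suc.prems[of m]]) auto
  then obtain l' r' where r': "strict_mono r'" "((\<lambda>k. X (r k) m) \<circ> r') \<longlonglongrightarrow> l'"
    using bounded_imp_convergent_subsequence by blast
  have "(\<lambda>k. X ((r \<circ> r') k) i) \<longlonglongrightarrow> (if i < m then l i else l')" if "i < Suc m" for i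
    using LIMSEQ_subseq_LIMSEQ[OF r(2)[rule_format, of i] r'(1)] r'(2) that
    by (cases "i = m") (auto simp: o_def)
  then show ?case
    by (intro exI[of _ "r \<circ> r'"] exI[of _ "\<lambda>i. if i < m then l i else l'"] conjI strict_mono_o[OF r(1) r'(1)]) blast
qed

section \<open>Comparison of defining functions\<close>

text \<open>The curve \<gamma>(t) = p + t v + s t^2 w has \<gamma>'(0) = v and \<gamma>''(0) = 2 s
  w, so the last two assumptions say that \<open>F\<close> along it has vanishing first and negative
  second derivative at 0.\<close>

lemma parabola_negative:
  fixes F :: "'a::euclidean_space \<Rightarrow> real"
  assumes "open S" "smooth_on S F" "p \<in> S" "F p = 0" "frechet_derivative F (at p) v = 0"
    and "frechet_derivative (\<lambda>q. frechet_derivative F (at q) v) (at p) v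
      + 2 * s * frechet_derivative F (at p) w < 0"
  shows "\<exists>d>0. \<forall>t. 0 < t \<and> t < d \<longrightarrow> F (p + t *\<^sub>R v + (s * t\<^sup>2) *\<^sub>R w) < 0"
proof -
  define \<gamma> where "\<gamma> = (\<lambda>t. p + t *\<^sub>R v + (s * t\<^sup>2) *\<^sub>R w)"
  have \<gamma>0: "\<gamma> 0 = p" by (simp add: \<gamma>_def)
  have \<gamma>': "(\<gamma> has_vector_derivative v + (2 * s * t) *\<^sub>R w) (at t)" for t
    unfolding \<gamma>_def
    by (auto intro!: derivative_eq_intros simp: has_vector_derivative_def algebra_simps)
  have "(\<gamma> \<longlongrightarrow> \<gamma> 0) (nhds 0)"
    unfolding \<gamma>_def by (intro tendsto_intros) (simp_all add: filterlim_ident)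
  then have "\<forall>\<^sub>F t in nhds 0. \<gamma> t \<in> S"
    using assms(1,3) \<gamma>0 by (intro topological_tendstoD) auto
  then obtain e where e: "e > 0" "\<And>t. \<bar>t\<bar> < e \<Longrightarrow> \<gamma> t \<in> S"
    by (auto simp: eventually_nhds_metric dist_real_def)
  have comp: "((\<lambda>t. G (\<gamma> t)) has_real_derivative
      frechet_derivative G (at (\<gamma> t)) v + 2 * s * t * frechet_derivative G (at (\<gamma> t)) w) (at t)"
    if "smooth_on S G" "\<gamma> t \<in> S" for G :: "'a \<Rightarrow> real" and t
  proof -
    have G: "(G has_derivative frechet_derivative G (at (\<gamma> t))) (at (\<gamma> t))"
      using smooth_on_imp_has_derivative that by blast
    note lin = has_derivative_linear[OF G]
    have "((\<lambda>t. G (\<gamma> t)) has_derivative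
        (\<lambda>h. frechet_derivative G (at (\<gamma> t)) (h *\<^sub>R (v + (2 * s * t) *\<^sub>R w)))) (at t)"
      using has_derivative_compose[OF \<gamma>'[unfolded has_vector_derivative_def] G] .
    then show ?thesis
      by (rule has_derivative_imp_has_field_derivative)
        (simp add: linear_scale[OF lin] linear_add[OF lin] algebra_simps)
  qed
  let ?\<phi>' = "\<lambda>t. frechet_derivative F (at (\<gamma> t)) v + 2 * s * t * frechet_derivative F (at (\<gamma> t)) w"
  have "(?\<phi>' has_real_derivative frechet_derivative (\<lambda>q. frechet_derivative F (at q) v) (at p) v
      + 2 * s * frechet_derivative F (at p) w) (at 0)"
  proof -
    note c = comp[OF smooth_on_derivative[OF assms(2)], of 0, unfolded \<gamma>0, OF assms(3)]
    have "((\<lambda>t. 2 * s * t) has_real_derivative 2 * s) (at 0)"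
      by (auto intro!: derivative_eq_intros)
    from DERIV_add[OF c[of v] DERIV_mult[OF this c[of w]]]
    show ?thesis by (simp add: \<gamma>0)
  qed
  from second_order_negative[OF e(1) comp[OF assms(2) e(2)] this]
  show ?thesis using assms(4-6) by (simp add: \<gamma>0 flip: \<gamma>_def) (simp add: \<gamma>_def)
qed

lemma line_negative:
  fixes F :: "'a::euclidean_space \<Rightarrow> real"
  assumes "open S" "smooth_on S F" "p \<in> S" "F p = 0" "frechet_derivative F (at p) v < 0"
  shows "\<exists>d>0. \<forall>t. 0 < t \<and> t < d \<longrightarrow> F (p + t *\<^sub>R v) < 0"
proof -
  note F = smooth_on_imp_has_derivative[OF assms(2,3)]
  have "((\<lambda>t. p + t *\<^sub>R v) has_derivative (\<lambda>h. h *\<^sub>R v)) (at 0)"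
    by (auto intro!: derivative_eq_intros)
  from has_derivative_compose[OF this, of F] F
  have "((\<lambda>t. F (p + t *\<^sub>R v)) has_derivative (\<lambda>h. frechet_derivative F (at p) (h *\<^sub>R v))) (at 0)"
    by simp
  then have "((\<lambda>t. F (p + t *\<^sub>R v)) has_real_derivative frechet_derivative F (at p) v) (at 0)"
    by (rule has_derivative_imp_has_field_derivative)
      (simp add: linear_scale[OF has_derivative_linear[OF F]])
  from DERIV_neg_dec_right[OF this assms(5)] show ?thesis using assms(4) by auto
qed

lemma common_small_parameter:
  assumes "\<exists>d>0. \<forall>t. 0 < t \<and> t < d \<longrightarrow> P t" "\<exists>d>0. \<forall>t::real. 0 < t \<and> t < d \<longrightarrow> Q t"
    "\<exists>d>0. \<forall>t. 0 < t \<and> t < d \<longrightarrow> R t"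
  shows "\<exists>t. P t \<and> Q t \<and> R t"
proof -
  have "\<forall>\<^sub>F t in at_right 0. P t" "\<forall>\<^sub>F t in at_right 0. Q t" "\<forall>\<^sub>F t in at_right 0. R t"
    unfolding eventually_at_right_field using assms by blast+
  then have "\<forall>\<^sub>F t in at_right 0. P t \<and> Q t \<and> R t" by (intro eventually_conj)
  from eventually_happens[OF this] show ?thesis by simp
qed

text \<open>A vector in the kernel of \<open>L\<close> but not of \<open>M\<close> could be added in
  any multiple to a vector where \<open>L\<close> is negative, leaving \<open>L\<close> unchanged
  and driving \<open>M\<close> above zero. So \<open>M\<close> is a multiple of \<open>L\<close>,
  and the assumption on signs makes the factor positive.\<close>

lemma proportional_functionals:
  fixes L M :: "'a::real_vector \<Rightarrow> real"
  assumes "linear L" "linear M" "\<And>v. L v < 0 \<Longrightarrow> M v \<le> 0" "L u \<noteq> 0" "M u' \<noteq> 0"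
  shows "\<exists>\<kappa>>0. \<forall>v. L v = \<kappa> * M v"
proof -
  define w where "w = (if L u < 0 then u else - u)"
  have w: "L w < 0" using assms(4) linear_neg[OF assms(1)] by (auto simp: w_def)
  have ker: "M v = 0" if "L v = 0" for v
  proof (rule ccontr)
    assume "M v \<noteq> 0"
    \<comment> \<open>This multiple makes \<open>M (w + n *\<^sub>R v)\<close> equal to 1.\<close>
    define n where "n = (1 - M w) / M v"
    have "M (w + n *\<^sub>R v) \<le> 0"
      using w that by (intro assms(3)) (simp add: linear_add[OF assms(1)] linear_scale[OF assms(1)])
    with \<open>M v \<noteq> 0\<close> show False
      by (simp add: linear_add[OF assms(2)] linear_scale[OF assms(2)] n_def)
  qed
  have M: "M v = (M w / L w) * L v" for v
    using ker[of "v - (L v / L w) *\<^sub>R w"] w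
    by (simp add: linear_diff[OF assms(1)] linear_scale[OF assms(1)] linear_diff[OF assms(2)] linear_scale[OF assms(2)])
  \<comment> \<open>If \<open>M w\<close> were zero, the formula just proved would make
    \<open>M\<close> vanish identically, against \<open>M u' \<noteq> 0\<close>.\<close>
  have "M w < 0" using assms(3)[OF w] M[of u'] assms(5) by (cases "M w = 0") auto
  then have "L w / M w > 0" using w by (simp add: zero_less_divide_iff)
  moreover have "L v = L w / M w * M v" for v
    using \<open>M w < 0\<close> w by (subst M[of v]) simp
  ultimately show ?thesis by blast
qed

text \<open>If \<open>D\<^sup>2F(v, v) < \<kappa> D\<^sup>2R(v, v)\<close>, then for a suitable bending \<open>s\<close> the parabola
  \<open>p + t v + s t\<^sup>2 w\<close> enters both \<open>{F < 0}\<close> and \<open>{R > 0}\<close>.\<close>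

lemma second_derivative_comparison:
  fixes F R :: "'a::euclidean_space \<Rightarrow> real"
  assumes "open S" "smooth_on S F" "smooth_on S R" "p \<in> S" "F p = 0" "R p = 0"
    and sign: "\<And>q. q \<in> S \<Longrightarrow> F q < 0 \<Longrightarrow> R q < 0"
    and nz: "frechet_derivative F (at p) u \<noteq> 0" "frechet_derivative R (at p) u' \<noteq> 0"
  shows "\<exists>\<kappa>>0. (\<forall>v. frechet_derivative F (at p) v = \<kappa> * frechet_derivative R (at p) v) \<and>
    (\<forall>v. frechet_derivative F (at p) v = 0 \<longrightarrow>
      \<kappa> * frechet_derivative (\<lambda>q. frechet_derivative R (at q) v) (at p) v
        \<le> frechet_derivative (\<lambda>q. frechet_derivative F (at q) v) (at p) v)"
proof -
  let ?F = "frechet_derivative F (at p)" and ?R = "frechet_derivative R (at p)"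
  have lin: "linear ?F" "linear ?R"
    using smooth_on_imp_differentiable linear_frechet_derivative assms by blast+
  \<comment> \<open>The assumption \<open>sign\<close> speaks of points of \<open>S\<close> only, so
    the test curves must stay there for small \<open>t\<close>.\<close>
  have near: "\<exists>d>0. \<forall>t. 0 < t \<and> t < d \<longrightarrow> p + t *\<^sub>R v + (s * t\<^sup>2) *\<^sub>R w \<in> S" for v w s
  proof -
    have "((\<lambda>t. p + t *\<^sub>R v + (s * t\<^sup>2) *\<^sub>R w) \<longlongrightarrow> p + 0 *\<^sub>R v + (s * 0\<^sup>2) *\<^sub>R w) (at_right 0)"
      by (intro tendsto_intros)
    then have "\<forall>\<^sub>F t in at_right 0. p + t *\<^sub>R v + (s * t\<^sup>2) *\<^sub>R w \<in> S"
      using assms(1,4) by (intro topological_tendstoD) auto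
    then show ?thesis by (auto simp: eventually_at_right_field)
  qed
  have mR: "smooth_on S (\<lambda>q. - R q)"
    using smooth_on_bounded_linear[OF assms(1) bounded_linear_minus[OF bounded_linear_ident] assms(3)] .
  have DmR: "frechet_derivative (\<lambda>q. - R q) (at q) v = - frechet_derivative R (at q) v" if "q \<in> S" for q v
    using has_derivative_eq_frechet_derivative[OF has_derivative_minus[OF smooth_on_imp_has_derivative[OF assms(3) that]], of v]
    by simp
  \<comment> \<open>Otherwise a short segment in the direction \<open>v\<close> would lie in both
    \<open>{F < 0}\<close> and \<open>{R > 0}\<close>.\<close>
  have "?R v \<le> 0" if "?F v < 0" for v
  proof (rule ccontr)
    assume "\<not> ?R v \<le> 0"
    then have "\<exists>d>0. \<forall>t. 0 < t \<and> t < d \<longrightarrow> - R (p + t *\<^sub>R v) < 0"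
      using assms(4,6) DmR by (intro line_negative[OF assms(1) mR]) auto
    from common_small_parameter[OF this line_negative[OF assms(1,2,4,5) that] near[of v 0 0]]
    show False using sign by fastforce
  qed
  from proportional_functionals[OF lin this nz] obtain \<kappa> where
    l: "\<kappa> > 0" "\<And>v. ?F v = \<kappa> * ?R v" by blast
  \<comment> \<open>Normalized so that bending along \<open>w\<close> adds \<open>2 * s\<close> to
    the second derivative of \<open>R\<close> and \<open>2 * s * \<kappa>\<close> to that of
    \<open>F\<close>.\<close>
  define w where "w = (1 / ?R u') *\<^sub>R u'"
  have w: "?R w = 1" using nz(2) by (simp add: w_def linear_scale[OF lin(2)])
  have "\<kappa> * frechet_derivative (\<lambda>q. frechet_derivative R (at q) v) (at p) v
        \<le> frechet_derivative (\<lambda>q. frechet_derivative F (at q) v) (at p) v" (is "\<kappa> * ?b \<le> ?a") if "?F v = 0" for v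
  proof (rule ccontr)
    assume "\<not> \<kappa> * ?b \<le> ?a"
    then have ab: "?a / \<kappa> < ?b" using l(1) by (simp add: field_simps)
    \<comment> \<open>\<open>- 2 * s\<close> is the midpoint between \<open>?a / \<kappa>\<close>
      and \<open>?b\<close>, so bending moves these two numbers to opposite sides of zero.\<close>
    define s where "s = - (?a / \<kappa> + ?b) / 4"
    have s: "?a / \<kappa> + 2 * s < 0" "?b + 2 * s > 0" using ab by (auto simp: s_def field_simps)
    have "?a + 2 * s * ?F w = \<kappa> * (?a / \<kappa> + 2 * s)" using l w by (simp add: algebra_simps)
    then have "?a + 2 * s * ?F w < 0" using s(1) l(1) by (simp add: mult_pos_neg)
    note F = parabola_negative[OF assms(1,2,4,5) that this]
    have "frechet_derivative (\<lambda>q. frechet_derivative (\<lambda>q. - R q) (at q) v) (at p) v = - ?b"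
    proof -
      have "((\<lambda>q. frechet_derivative R (at q) v) has_derivative
          frechet_derivative (\<lambda>q. frechet_derivative R (at q) v) (at p)) (at p)"
        using smooth_on_imp_has_derivative[OF smooth_on_derivative[OF assms(3)] assms(4)] .
      from has_derivative_transform_within_open[OF has_derivative_minus[OF this] assms(1,4), of "\<lambda>q. frechet_derivative (\<lambda>q. - R q) (at q) v"]
      show ?thesis using DmR by (intro has_derivative_eq_frechet_derivative[symmetric, where D = "\<lambda>u. - frechet_derivative (\<lambda>q. frechet_derivative R (at q) v) (at p) u"]) auto
    qed
    then have "\<exists>d>0. \<forall>t. 0 < t \<and> t < d \<longrightarrow> - R (p + t *\<^sub>R v + (s * t\<^sup>2) *\<^sub>R w) < 0"
      using s(2) l w that assms(4,6) DmR by (intro parabola_negative[OF assms(1) mR]) auto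
    from common_small_parameter[OF this F near[of v s w]]
    show False using sign by fastforce
  qed
  then show ?thesis using l by blast
qed

section \<open>Gromov manifolds\<close>

context manifold_with_connection
begin

lemma bilinear_hessian:
  assumes "open U" "smooth_fun_on A U f" "x \<in> U"
  shows "bilinear (hessian A nabla f x)"
  unfolding bilinear_def hessian_expansion[OF assms(1,2) chart_at_in_atlas in_chart_at assms(3)]
  by (simp only: chart_diff_chart_at, intro conjI allI bounded_linear.linear bounded_linear_sum bounded_linear_mult_const
      bounded_linear_const_mult bounded_linear_inner_left)

text \<open>The left side uses a different chart at every \<open>x\<close>, the right side only
  \<open>c\<close>; continuity in \<open>x\<close> is thereby inherited from the right side.\<close>

lemma hessian_coord_fields:
  assumes "open U" "smooth_fun_on A U f" "c \<in> A" "x \<in> fst c" "x \<in> U"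
  shows "hessian A nabla f x (coord_field A c u x) (coord_field A c v x) =
    field_hessian f (coord_field A c u) (coord_field A c v) x"
proof -
  have o: "open (U \<inter> fst c)" using assms by (simp add: open_Int open_chart_domain)
  have f: "smooth_fun_on A (U \<inter> fst c) f" by (rule smooth_fun_on_subset[OF assms(2)]) auto
  have E: "smooth_field_on A (U \<inter> fst c) (coord_field A c u)" for u
    by (rule smooth_field_on_subset[OF smooth_coord_field[OF assms(3)]]) simp
  show ?thesis
    using hessian_expansion[OF assms] field_hessian_expansion_chart[OF o f assms(3) _ _ E E, of x u v] assms(4,5)
    by simp
qed

text \<open>The vectors \<open>v k\<close> sit at varying points and are written in preferred charts
  that may change with \<open>k\<close>, so only their components in a fixed chart can converge. In
  these components the tensor is a finite sum with continuous coefficients.\<close>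

lemma tendsto_tensor:
  assumes "c \<in> A" "open D" "D \<subseteq> fst c" "x \<in> D" "\<And>y. y \<in> D \<Longrightarrow> bilinear (T y)"
    and "\<And>b b'. continuous_on D (\<lambda>y. T y (coord_field A c b y) (coord_field A c b' y))"
    and "y \<longlonglongrightarrow> x" "\<And>k. y k \<in> D"
    and "(\<lambda>k. chart_diff A c (y k) (v k)) \<longlonglongrightarrow> chart_diff A c x v0"
    and "(\<lambda>k. chart_diff A c (y k) (w k)) \<longlonglongrightarrow> chart_diff A c x w0"
  shows "(\<lambda>k. T (y k) (v k) (w k)) \<longlonglongrightarrow> (T x v0 w0 :: real)"
proof -
  define S where "S z p q = (\<Sum>b\<in>Basis. \<Sum>b'\<in>Basis. (p \<bullet> b) * (q \<bullet> b') *
      T z (coord_field A c b z) (coord_field A c b' z))" for z p q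
  have T: "T z v w = S z (chart_diff A c z v) (chart_diff A c z w)" if "z \<in> D" for z v w
  proof -
    have z: "z \<in> fst c" using that assms(3) by auto
    have "T z v w = T z (\<Sum>b\<in>Basis. (chart_diff A c z v \<bullet> b) *\<^sub>R coord_field A c b z)
        (\<Sum>b\<in>Basis. (chart_diff A c z w \<bullet> b) *\<^sub>R coord_field A c b z)"
      by (rule arg_cong2[OF vector_expansion[OF assms(1) z] vector_expansion[OF assms(1) z]])
    then show ?thesis unfolding bilinear_expansion[OF assms(5)[OF that]] S_def .
  qed
  have coeff: "(\<lambda>k. T (y k) (coord_field A c b (y k)) (coord_field A c b' (y k)))
      \<longlonglongrightarrow> T x (coord_field A c b x) (coord_field A c b' x)" for b b'
    using assms(6)[of b b'] assms(2,4,7)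
    by (auto simp: continuous_on_eq_continuous_at intro: isCont_tendsto_compose[where g = "\<lambda>y. T y (coord_field A c b y) (coord_field A c b' y)"])
  show ?thesis
    unfolding T[OF assms(4)] T[OF assms(8)]
    unfolding S_def by (intro tendsto_intros coeff assms(9,10))
qed

end

locale gromov = manifold_with_connection A nabla
  for A :: "('x::{t2_space,second_countable_topology}, 'e::euclidean_space) chart set" and nabla +
  fixes \<omega> :: "'x \<Rightarrow> 'e \<Rightarrow> 'e \<Rightarrow> real" and J :: "'x \<Rightarrow> 'e \<Rightarrow> 'e"
  assumes gromov: "gromov_manifold A \<omega> J"
begin

abbreviation "g \<equiv> gromov_metric \<omega> J"

lemma bilinear_\<omega>: "bilinear (\<omega> x)" and \<omega>_self: "\<omega> x v v = 0" and linear_J: "linear (J x)"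
  and J_J: "J x (J x v) = - v" and \<omega>_J: "\<omega> x (J x v) (J x w) = \<omega> x v w"
  and \<omega>_pos: "v \<noteq> 0 \<Longrightarrow> \<omega> x (J x v) v > 0"
proof -
  have "symplectic_form A \<omega>" "almost_complex_structure A J"
    "\<forall>x v w. \<omega> x (J x v) (J x w) = \<omega> x v w" "\<forall>x v. v \<noteq> 0 \<longrightarrow> \<omega> x (J x v) v > 0"
    using gromov by (simp_all add: gromov_manifold_def)
  then show "bilinear (\<omega> x)" "\<omega> x v v = 0" "linear (J x)" "J x (J x v) = - v"
    "\<omega> x (J x v) (J x w) = \<omega> x v w" "v \<noteq> 0 \<Longrightarrow> \<omega> x (J x v) v > 0"
    by (simp_all add: symplectic_form_def almost_complex_structure_def)
qed

lemma \<omega>_skew: "\<omega> x v w = - \<omega> x w v"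
  using \<omega>_self[of x "v + w"] \<omega>_self[of x v] \<omega>_self[of x w]
  by (simp add: bilinear_ladd[OF bilinear_\<omega>] bilinear_radd[OF bilinear_\<omega>])

lemma inner_form_g: "inner_form (g x)"
proof
  have "linear (\<lambda>v. \<omega> x (J x v) w)" for w
    using linear_compose[OF linear_J[of x], of "\<lambda>v. \<omega> x v w"] bilinear_\<omega> by (simp add: bilinear_def o_def)
  then show "bilinear (g x)"
    using bilinear_\<omega>[of x] unfolding bilinear_def gromov_metric_def by blast
  \<comment> \<open>Applying \<open>J\<close> to both arguments turns the left side into
    \<open>\<omega> x (- v) (J x w)\<close>, and skewness finishes.\<close>
  have "\<omega> x (J x v) w = \<omega> x (J x w) v" for v w
    using \<omega>_J[of x "J x v" w] \<omega>_skew[of x v "J x w"] by (simp add: J_J bilinear_lneg[OF bilinear_\<omega>])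
  then show "g x v w = g x w v" for v w by (simp add: gromov_metric_def)
  show "g x v v > 0" if "v \<noteq> 0" for v using \<omega>_pos[OF that] by (simp add: gromov_metric_def)
qed

lemmas bilinear_g = inner_form.bilinear[OF inner_form_g]

lemma continuous_on_\<omega>_coefficient:
  assumes "c \<in> A"
  shows "continuous_on (fst c) (\<lambda>x. \<omega> x (coord_field A c u x) (coord_field A c v x))"
proof (rule continuous_on_chart[OF assms order_refl])
  have "smooth_on (snd c ` fst c) (form_in_chart A \<omega> c u v)"
    using gromov assms unfolding gromov_manifold_def symplectic_form_def by blast
  then show "continuous_on (snd c ` fst c) ((\<lambda>x. \<omega> x (coord_field A c u x) (coord_field A c v x)) \<circ> param c)"
    unfolding form_in_chart_def by (rule smooth_on_imp_continuous_on)
qed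

lemma continuous_on_g_coefficient:
  assumes "c \<in> A"
  shows "continuous_on (fst c) (\<lambda>x. g x (coord_field A c u x) (coord_field A c v x))"
proof -
  let ?j = "\<lambda>x. chart_diff A c x (J x (coord_field A c u x))"
  have "smooth_on (snd c ` fst c) (?j \<circ> param c)"
    using gromov assms unfolding gromov_manifold_def almost_complex_structure_def by blast
  then have j: "continuous_on (fst c) ?j"
    by (intro continuous_on_chart[OF assms order_refl] smooth_on_imp_continuous_on)
  have "g x (coord_field A c u x) (coord_field A c v x) =
      (\<Sum>b\<in>Basis. (?j x \<bullet> b) * \<omega> x (coord_field A c b x) (coord_field A c v x))" if "x \<in> fst c" for x
  proof -
    have lin: "linear (\<lambda>z. \<omega> x z (coord_field A c v x))" using bilinear_\<omega> by (simp add: bilinear_def)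
    show ?thesis unfolding gromov_metric_def
      by (subst vector_expansion[OF assms that, of "J x (coord_field A c u x)"])
        (simp add: linear_sum[OF lin] linear_scale[OF lin])
  qed
  moreover have "continuous_on (fst c) (\<lambda>x. \<Sum>b\<in>Basis. (?j x \<bullet> b) * \<omega> x (coord_field A c b x) (coord_field A c v x))"
    by (intro continuous_intros j continuous_on_\<omega>_coefficient assms)
  ultimately show ?thesis by (metis (mono_tags, lifting) continuous_on_cong)
qed

text \<open>Compactness of the set of orthonormal frames rests on this bound: unit vectors at points
  near \<open>x\<close> have bounded components in the chart \<open>c\<close>. The form at
  \<open>x\<close> has a positive minimum on the unit sphere, and half of it survives a small change
  of the coefficients.\<close>

lemma metric_lower_bound:
  assumes "c \<in> A" "x \<in> fst c"
  obtains \<kappa> N where "\<kappa> > 0" "open N" "x \<in> N" "N \<subseteq> fst c"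
    "\<And>y v. y \<in> N \<Longrightarrow> \<kappa> * (norm (chart_diff A c y v))\<^sup>2 \<le> g y v v"
proof -
  define G where "G y u w = g y (coord_field A c u y) (coord_field A c w y)" for y u w
  have G: "bilinear (G y)" if "y \<in> fst c" for y
  proof -
    note l = linear_coord_field[OF assms(1) that]
    show ?thesis
      using linear_compose[OF l inner_form.linear_left[OF inner_form_g]]
        linear_compose[OF l inner_form.linear_right[OF inner_form_g]]
      by (simp add: bilinear_def G_def[abs_def] o_def)
  qed
  have expand: "G y u u = (\<Sum>b\<in>Basis. \<Sum>b'\<in>Basis. (u \<bullet> b) * (u \<bullet> b') * G y b b')" if "y \<in> fst c" for y u
    using bilinear_expansion[OF G[OF that], of "\<lambda>b. u \<bullet> b" "\<lambda>b. b" Basis "\<lambda>b. u \<bullet> b" "\<lambda>b. b" Basis]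
    by (simp add: euclidean_representation)
  have "continuous_on (sphere 0 1) (\<lambda>u. G x u u)"
    unfolding expand[OF assms(2)] by (intro continuous_intros)
  moreover have "sphere 0 1 \<noteq> ({} :: 'e set)" by simp
  ultimately obtain u0 where u0: "norm u0 = 1" "\<And>u. norm u = 1 \<Longrightarrow> G x u0 u0 \<le> G x u u"
    using continuous_attains_inf[OF compact_sphere, of 0 1 "\<lambda>u. G x u u"] by auto
  define \<kappa> where "\<kappa> = G x u0 u0 / 2"
  have "coord_field A c u0 x \<noteq> 0"
    using chart_diff_coord_field_self[OF assms, of u0] linear_0[OF linear_chart_diff[OF assms]] u0(1) by force
  then have \<kappa>: "\<kappa> > 0" using inner_form.pos[OF inner_form_g] by (simp add: \<kappa>_def G_def)
  have low: "2 * \<kappa> * (norm u)\<^sup>2 \<le> G x u u" for u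
  proof (cases "u = 0")
    case True
    then show ?thesis using bilinear_lzero[OF G[OF assms(2)]] by simp
  next
    case False
    define n where "n = (1 / norm u) *\<^sub>R u"
    have n: "norm n = 1" "u = norm u *\<^sub>R n" using False by (auto simp: n_def)
    have "G x u u = G x (norm u *\<^sub>R n) (norm u *\<^sub>R n)" by (rule arg_cong2[OF n(2) n(2)])
    also have "\<dots> = (norm u)\<^sup>2 * G x n n"
      by (simp add: bilinear_lmul[OF G[OF assms(2)]] bilinear_rmul[OF G[OF assms(2)]] power2_eq_square)
    finally show ?thesis using u0(2)[OF n(1)] by (simp add: \<kappa>_def mult.commute mult_right_mono)
  qed
  \<comment> \<open>Each of the \<open>DIM('e)\<close> squared coefficients moves by less than
    \<open>d\<close>, so the quadratic form changes by at most \<open>\<kappa>\<close> times the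
    squared norm, half of the bound available at \<open>x\<close>.\<close>
  define d where "d = \<kappa> / (real DIM('e))\<^sup>2"
  have d: "d > 0" using \<kappa> by (simp add: d_def)
  have "\<forall>\<^sub>F y in nhds x. \<bar>G y b b' - G x b b'\<bar> < d" for b b'
  proof -
    have "isCont (\<lambda>y. G y b b') x"
      using continuous_on_g_coefficient[OF assms(1)] assms open_chart_domain[OF assms(1)]
      by (simp add: continuous_on_eq_continuous_at G_def)
    then have "((\<lambda>y. G y b b') \<longlongrightarrow> G x b b') (nhds x)"
      by (simp add: continuous_at tendsto_nhds_iff)
    from tendstoD[OF this d] show ?thesis by (simp add: dist_real_def)
  qed
  then have "\<forall>\<^sub>F y in nhds x. (\<forall>b\<in>Basis. \<forall>b'\<in>Basis. \<bar>G y b b' - G x b b'\<bar> < d) \<and> y \<in> fst c"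
    using eventually_nhds_in_open[OF open_chart_domain[OF assms(1)] assms(2)]
    by (intro eventually_conj eventually_ball_finite ballI finite_Basis)
  then obtain N where N: "open N" "x \<in> N"
    "\<And>y. y \<in> N \<Longrightarrow> (\<forall>b\<in>Basis. \<forall>b'\<in>Basis. \<bar>G y b b' - G x b b'\<bar> < d) \<and> y \<in> fst c"
    unfolding eventually_nhds by blast
  have "\<kappa> * (norm (chart_diff A c y v))\<^sup>2 \<le> g y v v" if "y \<in> N" for y v
  proof -
    define u where "u = chart_diff A c y v"
    have y: "y \<in> fst c" using N(3)[OF that] by blast
    have "G x u u - G y u u = (\<Sum>b\<in>Basis. \<Sum>b'\<in>Basis. (u \<bullet> b) * (u \<bullet> b') * (G x b b' - G y b b'))"
      unfolding expand[OF y] expand[OF assms(2)] by (simp add: sum_subtractf right_diff_distrib)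
    also have "\<dots> \<le> (\<Sum>b\<in>(Basis::'e set). \<Sum>b'\<in>(Basis::'e set). (norm u)\<^sup>2 * d)"
    proof (intro sum_mono)
      fix b b' :: 'e assume b: "b \<in> Basis" "b' \<in> Basis"
      have "\<bar>(u \<bullet> b) * (u \<bullet> b') * (G x b b' - G y b b')\<bar> \<le> norm u * norm u * d"
        unfolding abs_mult using b N(3)[OF that] Basis_le_norm
        by (intro mult_mono) (auto simp: abs_minus_commute less_imp_le)
      then show "(u \<bullet> b) * (u \<bullet> b') * (G x b b' - G y b b') \<le> (norm u)\<^sup>2 * d"
        by (simp add: power2_eq_square)
    qed
    also have "\<dots> = \<kappa> * (norm u)\<^sup>2" by (simp add: d_def power2_eq_square)
    finally have "\<kappa> * (norm u)\<^sup>2 \<le> G y u u" using low[of u] by simp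
    then show ?thesis by (simp add: G_def u_def coord_field_chart_diff[OF assms(1) y])
  qed
  then show ?thesis using \<kappa> N that[of \<kappa> N] by blast
qed

text \<open>The inequality \<open>tr\<close> is used twice along convergent orthonormal frames. The
  Hessian traces converge, so their products with \<open>s\<close> tend to zero and
  \<open>d\<rho>\<close> must vanish on the limit plane. The traces of the square are nonnegative,
  so the Hessian traces are nonpositive already before the limit.\<close>

lemma limit_of_lagrangian_planes:
  assumes U: "open U" and \<rho>: "smooth_fun_on A U \<rho>" and x: "x \<in> U"
    and y: "y \<longlonglongrightarrow> x" and s: "s \<longlonglongrightarrow> 0" "\<And>k. s k > 0"
    and W: "\<And>k. lagrangian_plane \<omega> (y k) (W k)"
    and tr: "\<And>k. s k * trace_on (g (y k)) (W k) (hessian A nabla \<rho> (y k)) +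
      trace_on (g (y k)) (W k) (\<lambda>v w. differential A \<rho> (y k) v * differential A \<rho> (y k) w) \<le> 0"
  shows "\<exists>W. lagrangian_plane \<omega> x W \<and> W \<subseteq> {v. differential A \<rho> x v = 0} \<and>
    trace_on (g x) W (hessian A nabla \<rho> x) \<le> 0"
proof -
  let ?c = "chart_at A x"
  obtain \<kappa> N where N: "\<kappa> > 0" "open N" "x \<in> N" "N \<subseteq> fst ?c"
    "\<And>y v. y \<in> N \<Longrightarrow> \<kappa> * (norm (chart_diff A ?c y v))\<^sup>2 \<le> g y v v"
    by (rule metric_lower_bound[OF chart_at_in_atlas in_chart_at[of x]]) (rule that)
  define D where "D = U \<inter> N"
  have D: "open D" "D \<subseteq> fst ?c" "x \<in> D" using U N x by (auto simp: D_def)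
  obtain K where K: "\<And>k. k \<ge> K \<Longrightarrow> y k \<in> D"
    using topological_tendstoD[OF y D(1,3)] unfolding eventually_sequentially by blast
  \<comment> \<open>All the planes have half the dimension of \<open>'e\<close>, so frames of one
    common length serve the whole sequence.\<close>
  define m where "m = dim (W 0)"
  have dimW: "subspace (W k)" "dim (W k) = m" "2 * m = DIM('e)" for k
    using W[of k] W[of 0] unfolding lagrangian_plane_def m_def by auto
  have "\<exists>e. inner_form.orthonormal_frame (g (y k)) m e \<and> (\<forall>i<m. e i \<in> W k) \<and>
    (\<forall>B. trace_on (g (y k)) (W k) B = (\<Sum>i<m. B (e i) (e i)))" for k
    by (rule inner_form.trace_on_frame[OF inner_form_g dimW(1,2)[of k]]) blast
  then obtain e where e: "\<And>k. inner_form.orthonormal_frame (g (y k)) m (e k)" "\<And>k i. i < m \<Longrightarrow> e k i \<in> W k"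
    "\<And>k B. trace_on (g (y k)) (W k) B = (\<Sum>i<m. B (e k i) (e k i))" by metis
  \<comment> \<open>The shift by \<open>K\<close> puts every base point into \<open>D\<close>, where
    the fixed chart and the lower bound of the metric are available.\<close>
  define u where "u k i = chart_diff A ?c (y (k + K)) (e (k + K) i)" for k i
  have "bounded (range (\<lambda>k. u k i))" if "i < m" for i
  proof (rule boundedI, safe)
    fix k
    have "g (y (k + K)) (e (k + K) i) (e (k + K) i) = 1"
      using e(1)[of "k + K"] that unfolding inner_form.orthonormal_frame_def[OF inner_form_g] by simp
    moreover have "y (k + K) \<in> N" using K[of "k + K"] by (simp add: D_def)
    ultimately have "\<kappa> * (norm (u k i))\<^sup>2 \<le> 1" using N(5) unfolding u_def by metis
    then have "(norm (u k i))\<^sup>2 \<le> 1 / \<kappa>" using N(1) by (simp add: field_simps)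
    then show "norm (u k i) \<le> sqrt (1 / \<kappa>)" by (rule real_le_rsqrt)
  qed
  then obtain r l where r: "strict_mono r" "\<And>i. i < m \<Longrightarrow> (\<lambda>k. u (r k) i) \<longlonglongrightarrow> l i"
    using bounded_tuple_convergent_subsequence[of m u] by blast
  define q where "q k = r k + K" for k
  have q: "filterlim q sequentially sequentially"
    unfolding q_def by (rule filterlim_compose[OF filterlim_add_const_nat_at_top filterlim_subseq[OF r(1)]])
  have yq: "(\<lambda>k. y (q k)) \<longlonglongrightarrow> x" using filterlim_compose[OF y q] .
  have sq: "(\<lambda>k. s (q k)) \<longlonglongrightarrow> 0" using filterlim_compose[OF s(1) q] .
  have yD: "y (q k) \<in> D" for k using K by (simp add: q_def)
  \<comment> \<open>At \<open>x\<close> the chart \<open>?c\<close> is the preferred one, so the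
    limit of the components is itself a tangent vector at \<open>x\<close>.\<close>
  have lim: "(\<lambda>k. chart_diff A ?c (y (q k)) (e (q k) i)) \<longlonglongrightarrow> chart_diff A ?c x (l i)" if "i < m" for i
    using r(2)[OF that] by (simp add: u_def q_def chart_diff_chart_at)
  have T: "(\<lambda>k. T (y (q k)) (e (q k) i) (e (q k) j)) \<longlonglongrightarrow> (T x (l i) (l j) :: real)"
    if "\<And>y. y \<in> D \<Longrightarrow> bilinear (T y)" "i < m" "j < m"
      "\<And>b b'. continuous_on D (\<lambda>y. T y (coord_field A ?c b y) (coord_field A ?c b' y))" for T i j
    by (rule tendsto_tensor[OF chart_at_in_atlas D that(1,4) yq yD lim[OF that(2)] lim[OF that(3)]])
  have gl: "g x (l i) (l j) = (if i = j then 1 else 0)" if "i < m" "j < m" for i j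
  proof (rule LIMSEQ_unique)
    show "(\<lambda>k. g (y (q k)) (e (q k) i) (e (q k) j)) \<longlonglongrightarrow> g x (l i) (l j)"
      using continuous_on_g_coefficient[OF chart_at_in_atlas] D(2) that
      by (intro T bilinear_g) (auto intro: continuous_on_subset)
    show "(\<lambda>k. g (y (q k)) (e (q k) i) (e (q k) j)) \<longlonglongrightarrow> (if i = j then 1 else 0)"
      using e(1) that unfolding inner_form.orthonormal_frame_def[OF inner_form_g] by simp
  qed
  then have frame: "inner_form.orthonormal_frame (g x) m l"
    unfolding inner_form.orthonormal_frame_def[OF inner_form_g] by blast
  have \<omega>l: "\<omega> x (l i) (l j) = 0" if "i < m" "j < m" for i j
  proof (rule LIMSEQ_unique)
    show "(\<lambda>k. \<omega> (y (q k)) (e (q k) i) (e (q k) j)) \<longlonglongrightarrow> \<omega> x (l i) (l j)"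
      using continuous_on_\<omega>_coefficient[OF chart_at_in_atlas] D(2) that
      by (intro T bilinear_\<omega>) (auto intro: continuous_on_subset)
    show "(\<lambda>k. \<omega> (y (q k)) (e (q k) i) (e (q k) j)) \<longlonglongrightarrow> 0"
      using e(2) that W unfolding lagrangian_plane_def by simp
  qed
  have \<rho>D: "smooth_fun_on A D \<rho>" by (rule smooth_fun_on_subset[OF \<rho>]) (auto simp: D_def)
  define H where "H k = (\<Sum>i<m. hessian A nabla \<rho> (y (q k)) (e (q k) i) (e (q k) i))" for k
  define P where "P k = (\<Sum>i<m. differential A \<rho> (y (q k)) (e (q k) i) * differential A \<rho> (y (q k)) (e (q k) i))" for k
  have H: "H \<longlonglongrightarrow> (\<Sum>i<m. hessian A nabla \<rho> x (l i) (l i))"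
  proof -
    have "continuous_on (D \<inter> fst ?c) (field_hessian \<rho> (coord_field A ?c b) (coord_field A ?c b'))" for b b'
      using continuous_on_hessian_coefficient[OF D(1) \<rho>D chart_at_in_atlas] .
    then have "continuous_on D (field_hessian \<rho> (coord_field A ?c b) (coord_field A ?c b'))" for b b'
      using D(2) by (simp add: Int_absorb2)
    then have "continuous_on D (\<lambda>y. hessian A nabla \<rho> y (coord_field A ?c b y) (coord_field A ?c b' y))" for b b'
      by (rule continuous_on_eq) (use D(2) in \<open>auto simp: hessian_coord_fields[OF D(1) \<rho>D chart_at_in_atlas]\<close>)
    then show ?thesis
      unfolding H_def by (intro tendsto_sum T[OF bilinear_hessian[OF D(1) \<rho>D]]) auto
  qed
  have P: "P \<longlonglongrightarrow> (\<Sum>i<m. differential A \<rho> x (l i) * differential A \<rho> x (l i))"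
  proof -
    have "bilinear (\<lambda>v w. differential A \<rho> y v * differential A \<rho> y w)" if "y \<in> D" for y
      using linear_differential[OF \<rho>D that] by (auto simp: bilinear_def linear_iff algebra_simps)
    note bil = T[OF this]
    have "smooth_field_on A D (coord_field A ?c b)" for b
      by (rule smooth_field_on_subset[OF smooth_coord_field[OF chart_at_in_atlas] D(2)])
    then have "continuous_on D (\<lambda>y. differential A \<rho> y (coord_field A ?c b y) * differential A \<rho> y (coord_field A ?c b' y))" for b b'
      by (intro continuous_on_mult smooth_fun_on_imp_continuous_on[OF _ D(1)] smooth_fun_on_differential[OF D(1) \<rho>D])
    then show ?thesis
      unfolding P_def by (intro tendsto_sum bil) auto
  qed
  have HP: "s (q k) * H k + P k \<le> 0" for k
    using tr[of "q k"] unfolding e(3) H_def P_def .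
  have P0: "P k \<ge> 0" for k unfolding P_def by (intro sum_nonneg) simp
  have "(\<Sum>i<m. differential A \<rho> x (l i) * differential A \<rho> x (l i)) \<le> 0"
  proof (rule LIMSEQ_le[OF P])
    show "(\<lambda>k. - (s (q k) * H k)) \<longlonglongrightarrow> 0" using tendsto_minus[OF tendsto_mult[OF sq H]] by simp
    show "\<exists>N. \<forall>k\<ge>N. P k \<le> - (s (q k) * H k)"
    proof (intro exI allI impI)
      fix k show "P k \<le> - (s (q k) * H k)" using HP[of k] by linarith
    qed
  qed
  moreover have "(\<Sum>i<m. differential A \<rho> x (l i) * differential A \<rho> x (l i)) \<ge> 0"
    by (intro sum_nonneg) simp
  ultimately have "(\<Sum>i<m. differential A \<rho> x (l i) * differential A \<rho> x (l i)) = 0" by linarith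
  then have dl: "differential A \<rho> x (l i) = 0" if "i < m" for i
    using that by (subst (asm) sum_nonneg_eq_0_iff) auto
  have "H k \<le> 0" for k
  proof (rule ccontr)
    assume "\<not> H k \<le> 0"
    then have "s (q k) * H k > 0" using s(2) by simp
    with HP[of k] P0[of k] show False by linarith
  qed
  then have "(\<Sum>i<m. hessian A nabla \<rho> x (l i) (l i)) \<le> 0"
    using LIMSEQ_le_const2[OF H] by blast
  then have tr0: "trace_on (g x) (span (l ` {..<m})) (hessian A nabla \<rho> x) \<le> 0"
    using inner_form.trace_on_span_frame[OF inner_form_g frame bilinear_hessian[OF U \<rho> x]] by simp
  have ker: "span (l ` {..<m}) \<subseteq> {v. differential A \<rho> x v = 0}"
    using dl by (intro span_minimal linear_subspace_kernel linear_differential[OF \<rho> x]) auto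
  have "\<omega> x v w = 0" if "v \<in> span (l ` {..<m})" "w \<in> span (l ` {..<m})" for v w
  proof -
    note E = inner_form.orthonormal_expansion[OF inner_form_g inner_form.orthonormal_frame_set[OF inner_form_g frame]]
    have "\<omega> x v w = \<omega> x (\<Sum>e\<in>l ` {..<m}. g x v e *\<^sub>R e) (\<Sum>e\<in>l ` {..<m}. g x w e *\<^sub>R e)"
      by (rule arg_cong2[OF E[OF that(1)] E[OF that(2)]])
    also have "\<dots> = 0"
      unfolding bilinear_expansion[OF bilinear_\<omega>] using \<omega>l by (intro sum.neutral ballI) auto
    finally show ?thesis .
  qed
  then have "lagrangian_plane \<omega> x (span (l ` {..<m}))"
    using inner_form.dim_span_frame[OF inner_form_g frame] dimW(3) by (simp add: lagrangian_plane_def)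
  with tr0 ker show ?thesis by blast
qed

end

section \<open>Hessians of two defining functions at a boundary point\<close>

context manifold_with_connection
begin

text \<open>In its own chart the coordinate field has the constant components \<open>v\<close>, so
  differentiating twice along it gives the plain second derivative of \<open>F\<close>. The
  connection contributes only through the first derivative.\<close>

lemma hessian_in_chart_at:
  fixes v :: 'e
  assumes "open U" "smooth_fun_on A U f" "x \<in> U"
  defines "F \<equiv> f \<circ> param (chart_at A x)" and "p \<equiv> snd (chart_at A x) x"
    and "V \<equiv> coord_field A (chart_at A x) v"
  shows "hessian A nabla f x v v =
    frechet_derivative (\<lambda>q. frechet_derivative F (at q) v) (at p) v - frechet_derivative F (at p) (nabla V V x)"
proof -
  let ?c = "chart_at A x"
  note c = chart_at_in_atlas[of x] in_chart_at[of x]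
  have "frechet_derivative ((\<lambda>y. differential A f y (V y)) \<circ> param ?c) (at p) =
      frechet_derivative (\<lambda>q. frechet_derivative F (at q) v) (at p)"
  proof (rule frechet_derivative_cong_open[OF open_chart_image[OF c(1) assms(1)]])
    show "p \<in> snd ?c ` (fst ?c \<inter> U)" using c assms(3) by (auto simp: p_def)
    fix q assume "q \<in> snd ?c ` (fst ?c \<inter> U)"
    then obtain y where "y \<in> fst ?c" "y \<in> U" "q = snd ?c y" by auto
    then show "((\<lambda>y. differential A f y (V y)) \<circ> param ?c) q = frechet_derivative F (at q) v"
      using differential_chart[OF assms(2) c(1), of y "V y"] c
      by (simp add: V_def F_def param_chart chart_diff_coord_field_self)
  qed
  moreover have "V x = v" by (simp add: V_def coord_field_chart_at)
  ultimately show ?thesis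
    by (simp add: hessian_def Let_def differential_def F_def p_def flip: V_def)
qed

text \<open>Both connection terms apply a differential to the same vector, and the differentials are
  proportional with factor \<open>\<kappa>\<close>. They cancel in the comparison, which leaves the
  second derivatives in the chart.\<close>

lemma hessian_comparison:
  assumes "open U" "smooth_fun_on A U f" "smooth_fun_on A U h" "x \<in> U" "f x = 0" "h x = 0"
    and "\<And>y. y \<in> U \<Longrightarrow> f y < 0 \<Longrightarrow> h y < 0"
    and "differential A f x u \<noteq> 0" "differential A h x u' \<noteq> 0"
  shows "\<exists>\<kappa>>0. (\<forall>v. differential A f x v = \<kappa> * differential A h x v) \<and>
    (\<forall>v. differential A f x v = 0 \<longrightarrow> \<kappa> * hessian A nabla h x v v \<le> hessian A nabla f x v v)"
proof -
  let ?c = "chart_at A x"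
  note c = chart_at_in_atlas[of x] in_chart_at[of x]
  let ?S = "snd ?c ` (fst ?c \<inter> U)"
  have 1: "open ?S" "smooth_on ?S (f \<circ> param ?c)" "smooth_on ?S (h \<circ> param ?c)" "snd ?c x \<in> ?S"
    using open_chart_image[OF c(1) assms(1)] assms(2-4) c by (auto simp: smooth_fun_on_def)
  have 2: "(f \<circ> param ?c) (snd ?c x) = 0" "(h \<circ> param ?c) (snd ?c x) = 0"
    using assms(5,6) c by (simp_all add: param_chart)
  have 3: "(h \<circ> param ?c) q < 0" if "q \<in> ?S" "(f \<circ> param ?c) q < 0" for q
    using that assms(7) c by (auto simp: param_chart)
  from second_derivative_comparison[OF 1 2 3 assms(8,9)[unfolded differential_def]]
  obtain \<kappa> where k: "\<kappa> > 0" "\<And>v. differential A f x v = \<kappa> * differential A h x v"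
    "\<And>v. differential A f x v = 0 \<Longrightarrow>
      \<kappa> * frechet_derivative (\<lambda>q. frechet_derivative (h \<circ> param ?c) (at q) v) (at (snd ?c x)) v
        \<le> frechet_derivative (\<lambda>q. frechet_derivative (f \<circ> param ?c) (at q) v) (at (snd ?c x)) v"
    unfolding differential_def by blast
  have "\<kappa> * hessian A nabla h x v v \<le> hessian A nabla f x v v" if "differential A f x v = 0" for v
  proof -
    let ?V = "coord_field A ?c v"
    have "differential A f x (nabla ?V ?V x) = \<kappa> * differential A h x (nabla ?V ?V x)" by (rule k(2))
    then show ?thesis
      using k(3)[OF that] unfolding hessian_in_chart_at[OF assms(1,2,4)] hessian_in_chart_at[OF assms(1,3,4)]
      by (simp add: right_diff_distrib flip: differential_def)
  qed
  with k(1,2) show ?thesis by blast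
qed

end

context gromov
begin

lemma trace_on_combination:
  assumes "lagrangian_plane \<omega> x W" "\<And>v w. B v w = a * B1 v w + b * B2 v w"
  shows "trace_on (g x) W B = a * trace_on (g x) W B1 + b * trace_on (g x) W B2"
proof -
  obtain E where "\<And>B. trace_on (g x) W B = (\<Sum>e\<in>E. B e e)"
    using inner_form.trace_on_basis[OF inner_form_g, of W] assms(1) unfolding lagrangian_plane_def by metis
  then show ?thesis by (simp add: assms(2) sum.distrib sum_distrib_left)
qed

lemma trace_on_square_nonneg:
  assumes "lagrangian_plane \<omega> x W"
  shows "trace_on (g x) W (\<lambda>v w. L v * L w) \<ge> 0"
proof -
  obtain E where "\<And>B. trace_on (g x) W B = (\<Sum>e\<in>E. B e e)"
    using inner_form.trace_on_basis[OF inner_form_g, of W] assms unfolding lagrangian_plane_def by metis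
  then show ?thesis by (simp add: sum_nonneg)
qed

lemma trace_on_mono:
  assumes "lagrangian_plane \<omega> x W" "\<And>v. v \<in> W \<Longrightarrow> a * B1 v v \<le> B2 v v"
  shows "a * trace_on (g x) W B1 \<le> trace_on (g x) W B2"
proof -
  obtain E where E: "span E = W" "\<And>B. trace_on (g x) W B = (\<Sum>e\<in>E. B e e)"
    using inner_form.trace_on_basis[OF inner_form_g, of W] assms(1) unfolding lagrangian_plane_def by metis
  have "e \<in> W" if "e \<in> E" for e using that E(1) span_base by blast
  then show ?thesis unfolding E(2) sum_distrib_left by (intro sum_mono assms(2))
qed

lemma trace_hessian_compose:
  assumes "open U" "smooth_fun_on A U f" "x \<in> U"
    and "\<And>y. y \<in> U \<Longrightarrow> (\<phi> has_real_derivative \<phi>' (f y)) (at (f y))"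
    and "(\<phi>' has_real_derivative \<phi>'') (at (f x))" "smooth_on T \<phi>'" "f ` U \<subseteq> T"
    and "lagrangian_plane \<omega> x W"
  shows "trace_on (g x) W (hessian A nabla (\<lambda>y. \<phi> (f y)) x) =
    \<phi>' (f x) * trace_on (g x) W (hessian A nabla f x) +
    \<phi>'' * trace_on (g x) W (\<lambda>v w. differential A f x v * differential A f x w)"
  by (rule trace_on_combination[OF assms(8)]) (rule hessian_compose[OF assms(1-7)])

end

text \<open>Continuity gives \<open>\<rho> \<le> 0\<close> on the closure, and
  \<open>\<rho> x < 0\<close> would put \<open>x\<close> into the open set
  \<open>\<Omega>\<close>.\<close>

lemma frontier_defining_function:
  assumes "open \<Omega>" "closure \<Omega> \<subseteq> N" "\<Omega> = {x\<in>N. \<rho> x < (0::real)}" "open N" "continuous_on N \<rho>" "x \<in> frontier \<Omega>"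
  shows "\<rho> x = 0"
proof -
  have x: "x \<in> closure \<Omega>" "x \<notin> \<Omega>" using assms(1,6) by (auto simp: frontier_def interior_open)
  have "closure \<Omega> \<inter> {y. \<rho> y \<le> 0} = closure \<Omega> \<inter> \<rho> -` {..0}" by auto
  moreover have "closed (closure \<Omega> \<inter> \<rho> -` {..0})"
    using continuous_on_subset[OF assms(5,2)] by (intro continuous_closed_preimage) auto
  moreover have "\<Omega> \<subseteq> closure \<Omega> \<inter> \<rho> -` {..0}" using assms(3) closure_subset[of \<Omega>] by auto
  ultimately have "\<rho> x \<le> 0" using closure_minimal[of \<Omega>] x(1) by blast
  then show ?thesis using x assms(2,3) by force
qed

section \<open>The logarithm of the distance function near the boundary\<close>

context gromov
begin

context
  fixes \<Omega> N :: "'x set" and \<rho> :: "'x \<Rightarrow> real"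
  assumes \<Omega>: "open \<Omega>" "compact (closure \<Omega>)"
    and N: "open N" "closure \<Omega> \<subseteq> N" and \<rho>: "smooth_fun_on A N \<rho>" and \<Omega>_eq: "\<Omega> = {x\<in>N. \<rho> x < 0}"
    and \<rho>_regular: "\<And>x. x \<in> frontier \<Omega> \<Longrightarrow> \<exists>v. differential A \<rho> x v \<noteq> 0"
    and convex: "strictly_lagrangian_convex_boundary A \<omega> J nabla \<Omega>"
begin

lemma continuous_\<rho>: "continuous_on N \<rho>"
  using smooth_fun_on_imp_continuous_on[OF \<rho> N(1)] .

text \<open>Staying away from the value 0 keeps the set off the frontier, so it is a closed part of
  the compact closure.\<close>

lemma compact_inside:
  assumes "\<epsilon> > 0"
  shows "compact {x\<in>\<Omega>. \<rho> x \<le> - \<epsilon>}"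
proof -
  have "{x\<in>\<Omega>. \<rho> x \<le> - \<epsilon>} = closure \<Omega> \<inter> \<rho> -` {..- \<epsilon>}"
    using assms \<Omega>_eq N(2) closure_subset[of \<Omega>] by auto
  moreover have "closed (closure \<Omega> \<inter> \<rho> -` {..- \<epsilon>})"
    using continuous_on_subset[OF continuous_\<rho> N(2)] by (intro continuous_closed_preimage) auto
  ultimately show ?thesis
    using compact_Int_closed[OF \<Omega>(2), of "closure \<Omega> \<inter> \<rho> -` {..- \<epsilon>}"] by (simp add: Int_absorb1)
qed

text \<open>Convexity is known for some defining function \<open>r\<close>, while
  \<open>\<rho>\<close> is prescribed. On the common neighborhood both are negative exactly on
  \<open>\<Omega>\<close>, so the comparison applies with \<open>\<rho>\<close> on the larger side,
  the direction that carries positivity of the trace from \<open>r\<close> to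
  \<open>\<rho>\<close>.\<close>

lemma convex_wrt_defining_function:
  assumes "x \<in> frontier \<Omega>" "lagrangian_plane \<omega> x W" "W \<subseteq> {v. differential A \<rho> x v = 0}"
  shows "trace_on (g x) W (hessian A nabla \<rho> x) > 0"
proof -
  obtain r M where M: "open M" "closure \<Omega> \<subseteq> M" "smooth_fun_on A M r" "\<Omega> = {x\<in>M. r x < 0}"
      "\<exists>v. differential A r x v \<noteq> 0"
    and r: "\<And>W. lagrangian_plane \<omega> x W \<Longrightarrow> W \<subseteq> {v. differential A r x v = 0} \<Longrightarrow>
      trace_on (g x) W (hessian A nabla r x) > 0"
    using convex assms(1) unfolding strictly_lagrangian_convex_boundary_def defining_function_def by blast
  let ?U = "N \<inter> M"
  have x: "x \<in> ?U" using assms(1) N(2) M(2) by (auto simp: frontier_def)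
  have "\<rho> x = 0"
    using frontier_defining_function[OF \<Omega>(1) N(2) \<Omega>_eq N(1) continuous_\<rho> assms(1)] .
  moreover have "r x = 0"
    using frontier_defining_function[OF \<Omega>(1) M(2,4,1) smooth_fun_on_imp_continuous_on[OF M(3,1)] assms(1)] .
  moreover have "smooth_fun_on A ?U \<rho>" "smooth_fun_on A ?U r"
    using smooth_fun_on_subset[OF \<rho>, of ?U] smooth_fun_on_subset[OF M(3), of ?U] by auto
  moreover have "r y < 0" if "y \<in> ?U" "\<rho> y < 0" for y
  proof -
    have "y \<in> \<Omega>" using that \<Omega>_eq by blast
    then show ?thesis using M(4) by blast
  qed
  moreover obtain u u' where "differential A \<rho> x u \<noteq> 0" "differential A r x u' \<noteq> 0"
    using \<rho>_regular[OF assms(1)] M(5) by blast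
  ultimately obtain \<kappa> where k: "\<kappa> > 0" "\<And>v. differential A \<rho> x v = \<kappa> * differential A r x v"
    "\<And>v. differential A \<rho> x v = 0 \<Longrightarrow> \<kappa> * hessian A nabla r x v v \<le> hessian A nabla \<rho> x v v"
    using hessian_comparison[OF open_Int[OF N(1) M(1)], of \<rho> r x u u'] x by metis
  have "0 < \<kappa> * trace_on (g x) W (hessian A nabla r x)"
    using k(1,2) assms(3) by (intro mult_pos_pos r[OF assms(2)]) auto
  also have "\<dots> \<le> trace_on (g x) W (hessian A nabla \<rho> x)"
    using k(3) assms(3) by (intro trace_on_mono[OF assms(2)]) auto
  finally show ?thesis .
qed

text \<open>The expression is the trace for \<open>- ln (- \<rho>)\<close> multiplied by the square
  of \<open>\<rho>\<close>, which removes the singularity at the boundary and makes limits there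
  possible.\<close>

lemma trace_positive_near_boundary:
  "\<exists>\<epsilon>>0. \<forall>x\<in>\<Omega>. - \<rho> x < \<epsilon> \<longrightarrow> (\<forall>W. lagrangian_plane \<omega> x W \<longrightarrow>
    - \<rho> x * trace_on (g x) W (hessian A nabla \<rho> x) +
    trace_on (g x) W (\<lambda>v w. differential A \<rho> x v * differential A \<rho> x w) > 0)"
proof (rule ccontr)
  assume contra: "\<not> ?thesis"
  have "\<exists>y W. y \<in> \<Omega> \<and> - \<rho> y < inverse (real (Suc k)) \<and> lagrangian_plane \<omega> y W \<and>
    - \<rho> y * trace_on (g y) W (hessian A nabla \<rho> y) +
    trace_on (g y) W (\<lambda>v w. differential A \<rho> y v * differential A \<rho> y w) \<le> 0" for k
  proof -
    have "inverse (real (Suc k)) > 0" by simp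
    with contra show ?thesis by (meson not_less)
  qed
  then obtain y W where y: "\<And>k. y k \<in> \<Omega>" "\<And>k. - \<rho> (y k) < inverse (real (Suc k))"
    "\<And>k. lagrangian_plane \<omega> (y k) (W k)"
    "\<And>k. - \<rho> (y k) * trace_on (g (y k)) (W k) (hessian A nabla \<rho> (y k)) +
      trace_on (g (y k)) (W k) (\<lambda>v w. differential A \<rho> (y k) v * differential A \<rho> (y k) w) \<le> 0"
    by metis
  have "\<And>k. y k \<in> closure \<Omega>" using y(1) closure_subset by blast
  then obtain x q where x: "x \<in> closure \<Omega>" "strict_mono q" "(y \<circ> q) \<longlonglongrightarrow> x"
    using compact_imp_seq_compact[OF \<Omega>(2)] unfolding seq_compact_def by metis
  have xN: "x \<in> N" using x(1) N(2) by blast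
  have lim: "(\<lambda>k. \<rho> ((y \<circ> q) k)) \<longlonglongrightarrow> \<rho> x"
    using continuous_\<rho> N(1) xN by (intro isCont_tendsto_compose[OF _ x(3)]) (simp add: continuous_on_eq_continuous_at)
  have zero: "(\<lambda>k. - \<rho> ((y \<circ> q) k)) \<longlonglongrightarrow> 0"
  proof (rule tendsto_sandwich[OF _ _ tendsto_const])
    show "(\<lambda>k. inverse (real (Suc (q k)))) \<longlonglongrightarrow> 0"
      using LIMSEQ_subseq_LIMSEQ[OF LIMSEQ_inverse_real_of_nat x(2)] by (simp add: o_def)
    show "\<forall>\<^sub>F k in sequentially. 0 \<le> - \<rho> ((y \<circ> q) k)"
      using y(1) \<Omega>_eq by (intro always_eventually allI) (simp add: less_imp_le)
    show "\<forall>\<^sub>F k in sequentially. - \<rho> ((y \<circ> q) k) \<le> inverse (real (Suc (q k)))"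
      using y(2) by (intro always_eventually allI) (simp add: less_imp_le)
  qed
  \<comment> \<open>The shrinking bound on \<open>- \<rho>\<close> expels the limit from
    \<open>\<Omega>\<close>; lying in the closure, it is a frontier point, where convexity can be
    applied.\<close>
  have "\<rho> x = 0" using LIMSEQ_unique[OF tendsto_minus[OF lim] zero] by simp
  then have "x \<notin> \<Omega>" using \<Omega>_eq by auto
  then have fr: "x \<in> frontier \<Omega>" using x(1) \<Omega>(1) by (simp add: frontier_def interior_open)
  have "- \<rho> ((y \<circ> q) k) > 0" for k
  proof -
    have "y (q k) \<in> \<Omega>" by (rule y(1))
    then show ?thesis using \<Omega>_eq by auto
  qed
  from limit_of_lagrangian_planes[OF N(1) \<rho> xN x(3) zero this, of "W \<circ> q"] y(3,4)
  obtain W where "lagrangian_plane \<omega> x W" "W \<subseteq> {v. differential A \<rho> x v = 0}"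
    "trace_on (g x) W (hessian A nabla \<rho> x) \<le> 0" by auto
  with convex_wrt_defining_function[OF fr] show False by fastforce
qed

lemma smooth_minus_ln: "smooth_fun_on A \<Omega> (\<lambda>x. - ln (- \<rho> x))"
  using smooth_fun_on_compose[OF \<Omega>(1) smooth_fun_on_subset[OF \<rho>] smooth_on_minus_ln_minus] \<Omega>_eq by auto

lemma trace_minus_ln:
  assumes "x \<in> \<Omega>" "lagrangian_plane \<omega> x W"
  shows "trace_on (g x) W (hessian A nabla (\<lambda>x. - ln (- \<rho> x)) x) =
    (- \<rho> x * trace_on (g x) W (hessian A nabla \<rho> x) +
    trace_on (g x) W (\<lambda>v w. differential A \<rho> x v * differential A \<rho> x w)) / (\<rho> x)\<^sup>2"
proof -
  have neg: "\<rho> y < 0" if "y \<in> \<Omega>" for y using that \<Omega>_eq by blast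
  have o: "open {t::real. t < 0}" by (simp add: open_lessThan flip: lessThan_def)
  have "trace_on (g x) W (hessian A nabla (\<lambda>x. - ln (- \<rho> x)) x) =
    - inverse (\<rho> x) * trace_on (g x) W (hessian A nabla \<rho> x) +
    1 / (\<rho> x)\<^sup>2 * trace_on (g x) W (\<lambda>v w. differential A \<rho> x v * differential A \<rho> x w)"
  proof (rule trace_hessian_compose[OF \<Omega>(1) _ assms(1) _ _ _ _ assms(2), where T = "{t. t < 0}" and \<phi>' = "\<lambda>t. - inverse t"])
    show "smooth_fun_on A \<Omega> \<rho>" using smooth_fun_on_subset[OF \<rho>] \<Omega>_eq by auto
    show "((\<lambda>t. - ln (- t)) has_real_derivative - inverse (\<rho> y)) (at (\<rho> y))" if "y \<in> \<Omega>" for y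
      using neg[OF that] by (auto intro!: derivative_eq_intros simp: field_simps)
    show "((\<lambda>t. - inverse t) has_real_derivative 1 / (\<rho> x)\<^sup>2) (at (\<rho> x))"
      using neg[OF assms(1)] by (auto intro!: derivative_eq_intros simp: field_simps power2_eq_square)
    show "smooth_on {t. t < 0} (\<lambda>t::real. - inverse t)"
      using smooth_on_bounded_linear[OF o bounded_linear_minus[OF bounded_linear_ident] smooth_on_inverse] .
    show "\<rho> ` \<Omega> \<subseteq> {t. t < 0}" using neg by auto
  qed
  then show ?thesis using neg[OF assms(1)] by (simp add: field_simps power2_eq_square)
qed

lemma minus_ln_strictly_psh:
  obtains \<epsilon> where "\<epsilon> > 0"
    "\<And>x W. x \<in> \<Omega> \<Longrightarrow> - \<epsilon> < \<rho> x \<Longrightarrow> lagrangian_plane \<omega> x W \<Longrightarrow>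
      trace_on (g x) W (hessian A nabla (\<lambda>x. - ln (- \<rho> x)) x) > 0"
proof -
  obtain \<epsilon> where e: "\<epsilon> > 0" "\<And>x W. x \<in> \<Omega> \<Longrightarrow> - \<rho> x < \<epsilon> \<Longrightarrow> lagrangian_plane \<omega> x W \<Longrightarrow>
    - \<rho> x * trace_on (g x) W (hessian A nabla \<rho> x) +
    trace_on (g x) W (\<lambda>v w. differential A \<rho> x v * differential A \<rho> x w) > 0"
    using trace_positive_near_boundary by blast
  show ?thesis
  proof (rule that[OF e(1)])
    fix x W assume a: "x \<in> \<Omega>" "- \<epsilon> < \<rho> x" "lagrangian_plane \<omega> x W"
    have "(\<rho> x)\<^sup>2 > 0" using a(1) \<Omega>_eq by auto
    with e(2)[OF a(1) _ a(3)] a(2) show "trace_on (g x) W (hessian A nabla (\<lambda>x. - ln (- \<rho> x)) x) > 0"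
      unfolding trace_minus_ln[OF a(1,3)] by (intro divide_pos_pos) auto
  qed
qed

lemma sublevel_minus_ln: "{x\<in>\<Omega>. - ln (- \<rho> x) \<le> b} = {x\<in>\<Omega>. \<rho> x \<le> - exp (- b)}"
proof -
  have "- ln (- \<rho> x) \<le> b \<longleftrightarrow> \<rho> x \<le> - exp (- b)" if "x \<in> \<Omega>" for x
  proof -
    have "- \<rho> x > 0" using that \<Omega>_eq by auto
    then have "- b \<le> ln (- \<rho> x) \<longleftrightarrow> exp (- b) \<le> - \<rho> x" by (rule ln_ge_iff)
    then show ?thesis by linarith
  qed
  then show ?thesis by auto
qed

section \<open>Strict plurisubharmonicity outside a compact set and the exhaustion function\<close>

lemma convex_at_infinity:
  "\<exists>K. compact K \<and> K \<subseteq> \<Omega> \<and> strictly_lagrangian_psh_on A \<omega> J nabla (\<Omega> - K) (\<lambda>x. - ln (- \<rho> x))"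
  "strictly_lagrangian_convex_at_infinity A \<omega> J nabla \<Omega>"
proof -
  obtain \<epsilon> where \<epsilon>: "\<epsilon> > 0" "\<And>x W. x \<in> \<Omega> \<Longrightarrow> - \<epsilon> < \<rho> x \<Longrightarrow> lagrangian_plane \<omega> x W \<Longrightarrow>
      trace_on (g x) W (hessian A nabla (\<lambda>x. - ln (- \<rho> x)) x) > 0"
    by (rule minus_ln_strictly_psh) (rule that)
  define v where "v = (\<lambda>x. - ln (- \<rho> x))"
  \<comment> \<open>Since \<open>exp (- a) = \<epsilon>\<close>, the condition
    \<open>v x > a\<close> describes exactly the collar \<open>\<rho> x > - \<epsilon>\<close> in
    which positivity is known.\<close>
  define a where "a = - ln \<epsilon>"
  define K where "K = {x\<in>\<Omega>. v x \<le> a}"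
  have Kb: "compact {x\<in>\<Omega>. v x \<le> b}" for b
    unfolding v_def sublevel_minus_ln by (rule compact_inside) simp
  have K: "compact K" "K \<subseteq> \<Omega>" unfolding K_def by (rule Kb) auto
  have pos: "trace_on (g x) W (hessian A nabla v x) > 0" if "x \<in> \<Omega>" "v x > a" "lagrangian_plane \<omega> x W" for x W
  proof -
    have "x \<notin> {x\<in>\<Omega>. - ln (- \<rho> x) \<le> a}" using that(2) by (simp add: v_def)
    then have "- \<epsilon> < \<rho> x" using that(1) \<epsilon>(1) unfolding sublevel_minus_ln by (simp add: a_def)
    from \<epsilon>(2)[OF that(1) this that(3)] show ?thesis by (simp add: v_def)
  qed
  have sv: "smooth_fun_on A \<Omega> v" using smooth_minus_ln by (simp add: v_def)
  have outside: "x \<in> \<Omega>" "a < v x" if "x \<in> \<Omega> - K" for x using that by (auto simp: K_def)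
  have strict: "strictly_lagrangian_psh_on A \<omega> J nabla (\<Omega> - K) v"
    using pos[OF outside] smooth_fun_on_subset[OF sv, of "\<Omega> - K"] by (simp add: strictly_lagrangian_psh_on_def)
  with K show "\<exists>K. compact K \<and> K \<subseteq> \<Omega> \<and> strictly_lagrangian_psh_on A \<omega> J nabla (\<Omega> - K) (\<lambda>x. - ln (- \<rho> x))"
    by (auto simp: v_def)
  have end_function: "has_strict_lagrangian_psh_end_function A \<omega> J nabla \<Omega>"
    unfolding has_strict_lagrangian_psh_end_function_def
  proof (rule exI[of _ K], rule exI[of _ v], intro conjI K strict allI)
    fix b
    \<comment> \<open>The maximum with \<open>a\<close> in the witness makes it contain
      \<open>K\<close> for small \<open>b\<close> as well.\<close>
    show "\<exists>L. compact L \<and> K \<subseteq> L \<and> L \<subseteq> \<Omega> \<and> (\<forall>x\<in>\<Omega> - L. b < v x)"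
      by (intro exI[of _ "{x\<in>\<Omega>. v x \<le> max a b}"] conjI Kb) (auto simp: K_def)
  qed
  \<comment> \<open>The shift by \<open>a\<close> switches the cutoff on only where \<open>v\<close>
    is known to be strictly plurisubharmonic, so the sign of its Hessian on \<open>K\<close> does
    not matter.\<close>
  define f where "f = (\<lambda>x. convex_cutoff (v x - a))"
  have sshift: "smooth_on UNIV (\<lambda>t::real. \<phi> (t - a))" if "smooth_on UNIV \<phi>" for \<phi> :: "real \<Rightarrow> real"
    using smooth_on_compose[OF open_UNIV smooth_on_add[OF open_UNIV smooth_on_id smooth_on_const[of _ "- a"]] that]
    by simp
  have tf: "trace_on (g x) W (hessian A nabla f x) =
    (flat 0 (v x - a) + flat 1 (v x - a)) * trace_on (g x) W (hessian A nabla v x) +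
    flat 3 (v x - a) * trace_on (g x) W (\<lambda>u w. differential A v x u * differential A v x w)"
    if "x \<in> \<Omega>" "lagrangian_plane \<omega> x W" for x W
    unfolding f_def
  proof (rule trace_hessian_compose[OF \<Omega>(1) sv that(1) _ _ _ _ that(2), where T = UNIV and
        \<phi> = "\<lambda>t. convex_cutoff (t - a)" and \<phi>' = "\<lambda>t. flat 0 (t - a) + flat 1 (t - a)"])
    show "((\<lambda>t. convex_cutoff (t - a)) has_real_derivative flat 0 (v y - a) + flat 1 (v y - a)) (at (v y))" for y
      using DERIV_shift[of convex_cutoff "flat 0 (v y - a) + flat 1 (v y - a)" "v y" "- a"] convex_cutoff_has_derivative[of "v y - a"]
      by simp
    show "((\<lambda>t. flat 0 (t - a) + flat 1 (t - a)) has_real_derivative flat 3 (v x - a)) (at (v x))"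
      using DERIV_shift[of "\<lambda>t. flat 0 t + flat 1 t" "flat 3 (v x - a)" "v x" "- a"] convex_cutoff_has_second_derivative[of "v x - a"]
      by simp
    show "smooth_on UNIV (\<lambda>t. flat 0 (t - a) + flat 1 (t - a))"
      by (intro smooth_on_add open_UNIV sshift smooth_on_flat)
  qed simp
  have flat_nonneg: "flat n t \<ge> 0" for n t by (simp add: flat_def)
  have f_pos: "trace_on (g x) W (hessian A nabla f x) > 0"
    if "x \<in> \<Omega>" "v x > a" "lagrangian_plane \<omega> x W" for x W
  proof -
    have "flat 0 (v x - a) > 0" using that(2) by (simp add: flat_def)
    then have "(flat 0 (v x - a) + flat 1 (v x - a)) * trace_on (g x) W (hessian A nabla v x) > 0"
      using pos[OF that] flat_nonneg[of 1 "v x - a"] by (intro mult_pos_pos add_pos_nonneg)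
    then show ?thesis unfolding tf[OF that(1,3)]
      by (intro add_pos_nonneg mult_nonneg_nonneg flat_nonneg trace_on_square_nonneg that(3))
  qed
  have f_nonneg: "trace_on (g x) W (hessian A nabla f x) \<ge> 0"
    if "x \<in> \<Omega>" "lagrangian_plane \<omega> x W" for x W
  proof (cases "v x > a")
    case True
    then show ?thesis using f_pos[OF that(1) _ that(2)] by simp
  next
    case False
    then show ?thesis unfolding tf[OF that] by (simp add: flat_def)
  qed
  have sf: "smooth_fun_on A \<Omega> f"
    unfolding f_def by (rule smooth_fun_on_compose[OF \<Omega>(1) sv sshift[OF smooth_on_convex_cutoff]]) simp
  have "compact {x\<in>\<Omega>. f x \<le> b}" for b
  proof -
    \<comment> \<open>For \<open>v x - a \<ge> 1\<close> the cutoff is at least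
      \<open>(v x - a) * exp (- 1)\<close>, which gives the bound \<open>b * exp 1\<close>; the
      maximum with 1 covers the remaining points.\<close>
    let ?C = "{x\<in>\<Omega>. v x \<le> a + max 1 (b * exp 1)}"
    have "v x \<le> a + max 1 (b * exp 1)" if "f x \<le> b" for x
    proof (rule ccontr)
      assume n: "\<not> ?thesis"
      then have "v x - a \<ge> 1" by linarith
      from convex_cutoff_ge[OF this] have "(v x - a) * exp (- 1) \<le> b" using that by (simp add: f_def)
      then have "v x - a \<le> b * exp 1" by (simp add: exp_minus field_simps)
      with n show False by linarith
    qed
    \<comment> \<open>Continuity of \<open>f\<close> is available on \<open>\<Omega>\<close>;
      restricted to the closed set \<open>?C\<close>, its sublevel set is closed in the whole
      manifold.\<close>
    then have eq: "{x\<in>\<Omega>. f x \<le> b} = ?C \<inter> (?C \<inter> f -` {..b})" by auto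
    have "closed (?C \<inter> f -` {..b})"
      using continuous_on_subset[OF smooth_fun_on_imp_continuous_on[OF sf \<Omega>(1)], of ?C]
      by (intro continuous_closed_preimage compact_imp_closed[OF Kb]) auto
    then show ?thesis unfolding eq by (rule compact_Int_closed[OF Kb])
  qed
  moreover have "lagrangian_psh_on A \<omega> J nabla \<Omega> f"
    using sf f_nonneg by (simp add: lagrangian_psh_on_def)
  moreover have "strictly_lagrangian_psh_on A \<omega> J nabla (\<Omega> - K) f"
    using f_pos[OF outside] smooth_fun_on_subset[OF sf, of "\<Omega> - K"] by (simp add: strictly_lagrangian_psh_on_def)
  ultimately have "has_lagrangian_psh_exhaustion A \<omega> J nabla \<Omega>"
    unfolding has_lagrangian_psh_exhaustion_def using K by blast
  with end_function show "strictly_lagrangian_convex_at_infinity A \<omega> J nabla \<Omega>"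
    by (simp add: strictly_lagrangian_convex_at_infinity_def)
qed

end

end

theorem theorem10p5:
  fixes A :: "('x::{t2_space,second_countable_topology}, 'e::euclidean_space) chart set"
    and \<omega> :: "'x \<Rightarrow> 'e \<Rightarrow> 'e \<Rightarrow> real"
    and J :: "'x \<Rightarrow> 'e \<Rightarrow> 'e"
    and nabla :: "('x \<Rightarrow> 'e) \<Rightarrow> ('x \<Rightarrow> 'e) \<Rightarrow> 'x \<Rightarrow> 'e"
    and \<Omega> :: "'x set"
    and \<rho> \<delta> :: "'x \<Rightarrow> real"
  assumes "gromov_manifold A \<omega> J"
    and "levi_civita_connection A (gromov_metric \<omega> J) nabla"
    and "\<not> compact (UNIV :: 'x set)"
    and "compact_domain A \<Omega>"
    and "strictly_lagrangian_convex_boundary A \<omega> J nabla \<Omega>"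
    and "defining_function A \<Omega> \<rho>"
    and "\<delta> = (\<lambda>x. - \<rho> x)"
  shows "(\<exists>K. compact K \<and> K \<subseteq> \<Omega> \<and>
            strictly_lagrangian_psh_on A \<omega> J nabla (\<Omega> - K) (\<lambda>x. - ln (\<delta> x))) \<and>
         strictly_lagrangian_convex_at_infinity A \<omega> J nabla \<Omega>"
proof -
  interpret gromov A nabla \<omega> J
    using assms(1,2) by unfold_locales (simp_all add: gromov_manifold_def levi_civita_connection_def)
  obtain N where "open N" "closure \<Omega> \<subseteq> N" "smooth_fun_on A N \<rho>" "\<Omega> = {x\<in>N. \<rho> x < 0}"
    "\<And>x. x \<in> frontier \<Omega> \<Longrightarrow> \<exists>v. differential A \<rho> x v \<noteq> 0"
    using assms(6) unfolding defining_function_def by blast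
  moreover have "open \<Omega>" "compact (closure \<Omega>)" using assms(4) by (auto simp: compact_domain_def)
  ultimately show ?thesis
    using convex_at_infinity[of \<Omega> N \<rho>] assms(5) unfolding assms(7) by blast
qed

end
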